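(* Let $\Sigma$ be a finite group acting on $\mathcal{X}$, let $\mathcal{X}_0\subset\mathcal{X}$ be a fundamental domain of $\mathcal{X}$ under the $\Sigma$-action, and let $\mathcal{H}$ be a reproducing kernel Hilbert space on $\mathcal{X}$ whose kernel $k$ satisfies: (i) $k(x,y)\geq0$ and $k(\sigma x,\sigma y)=k(x,y)$ for all $\sigma\in\Sigma$, $x,y\in\mathcal{X}$; (ii) with $K:=\max_{x,y\in\mathcal{X}}k(x,y)$, one has $k(x,y)=K$ if and only if $x=y$; (iii) there exists $c\in(0,1)$ such that $k(\sigma x,x)\leq cK$ for every $\sigma\in\Sigma$ that is not the identity element and every $x\in\mathcal{X}_0$. Suppose $P$ and $Q$ are $\Sigma$-invariant probability distributions on $\mathcal{X}$, with empirical measures $P_m$, $Q_n$ of $m$ i.i.d. samples from $P$ and $n$ i.i.d. samples from $Q$. Then for $m,n$ sufficiently large and any $\epsilon>0$ we have with probability at least $1-\epsilon$, \begin{align*} |\mathrm{MMD}(P,Q)-\mathrm{MMD}^{\Sigma}(P_m,Q_n)|&<2K^{\frac12}\left[1+c(|\Sigma|-1)\right]^{\frac12}\left(\frac{1}{\sqrt{|\Sigma|m}}+\frac{1}{\sqrt{|\Sigma|n}}\right)\\ &\quad+\sqrt{\frac{2K(1+c(|\Sigma|-1))\ln(\frac1\epsilon)}{|\Sigma|}}\sqrt{\frac1m+\frac1n}. \end{align*}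
   Context: $\mathcal{X}\subset\mathbb{R}^D$ is a bounded set. The action of $\sigma\in\Sigma$ on $x\in\mathcal{X}$ is written $\sigma x$. A subset $\mathcal{X}_0\subset\mathcal{X}$ is a fundamental domain if for each $x\in\mathcal{X}$ there exists a unique $x_0\in\mathcal{X}_0$ such that $x=\sigma x_0$ for some $\sigma\in\Sigma$ (the paper writes $\mathcal{X}=\Sigma\times\mathcal{X}_0$). A probability measure $P$ on $\mathcal{X}$ is $\Sigma$-invariant if its push-forward under $x\mapsto\sigma x$ equals $P$ for every $\sigma\in\Sigma$. $B_{\mathcal{H}}=\{\gamma\in\mathcal{H}:\|\gamma\|_{\mathcal{H}}\le1\}$ is the unit ball of $\mathcal{H}$, and $[B_{\mathcal{H}}]_\Sigma=\{\gamma\in B_{\mathcal{H}}:\gamma(\sigma x)=\gamma(x)\ \forall\sigma\in\Sigma,x\in\mathcal{X}\}$. For probability measures $\mu,\nu$ on $\mathcal{X}$, $$\mathrm{MMD}(\mu,\nu)=\sup_{\gamma\in B_{\mathcal{H}}}\{E_\mu[\gamma]-E_\nu[\gamma]\},\qquad\mathrm{MMD}^\Sigma(\mu,\nu)=\sup_{\gamma\in[B_{\mathcal{H}}]_\Sigma}\{E_\mu[\gamma]-E_\nu[\gamma]\}.$$ The samples $x_1,\dots,x_m\sim P$ and $y_1,\dots,y_n\sim Q$ are all independent, $P_m=\frac1m\sum_{i=1}^m\delta_{x_i}$, $Q_n=\frac1n\sum_{j=1}^n\delta_{y_j}$, and probability is with respect to the samples.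
   Formalization: The formal statement assumes K > 0 (if K = 0, then X is one point, k = 0, and the strict inequality reads 0 < 0) and makes explicit that the kernel k is jointly Borel measurable, so that the expectations and the probability are defined. *)

theory Defs
  imports "HOL-Probability.Probability" "HOL-Algebra.Group_Action"
begin

definition fundamental_domain ::
    "('g, 'm) monoid_scheme \<Rightarrow> 'a set \<Rightarrow> ('g \<Rightarrow> 'a \<Rightarrow> 'a) \<Rightarrow> 'a set \<Rightarrow> bool" where
  "fundamental_domain G X \<phi> X0 \<longleftrightarrow>
     X0 \<subseteq> X \<and> (\<forall>x\<in>X. \<exists>!x0. x0 \<in> X0 \<and> (\<exists>\<sigma>\<in>carrier G. x = \<phi> \<sigma> x0))"

text \<open>
  A Hilbert space of functions on \<open>X\<close> is given by a Hilbert space \<open>'h\<close> together with a linear map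
  \<open>fun_of\<close> into the functions on \<open>X\<close> that is injective, i.e. an element of \<open>'h\<close> is determined by its
  values on \<open>X\<close>. The values of \<open>fun_of f\<close> and \<open>k\<close> outside \<open>X\<close> carry no meaning.
\<close>

definition rkhs_on ::
    "'a set \<Rightarrow> ('h :: {real_inner, complete_space} \<Rightarrow> 'a \<Rightarrow> real) \<Rightarrow> ('a \<Rightarrow> 'a \<Rightarrow> real) \<Rightarrow> bool" where
  "rkhs_on X fun_of k \<longleftrightarrow>
     (\<forall>f g. \<forall>x\<in>X. fun_of (f + g) x = fun_of f x + fun_of g x) \<and>
     (\<forall>a f. \<forall>x\<in>X. fun_of (a *\<^sub>R f) x = a * fun_of f x) \<and>
     (\<forall>f g. (\<forall>x\<in>X. fun_of f x = fun_of g x) \<longrightarrow> f = g) \<and>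
     (\<forall>x\<in>X. \<exists>h. (\<forall>y\<in>X. fun_of h y = k y x) \<and> (\<forall>f. fun_of f x = f \<bullet> h))"

text \<open>The measurability conjunct makes the push-forward meaningful: \<open>distr\<close> is total.\<close>

definition invariant_measure ::
    "('g, 'm) monoid_scheme \<Rightarrow> ('g \<Rightarrow> 'a \<Rightarrow> 'a) \<Rightarrow> 'a measure \<Rightarrow> bool" where
  "invariant_measure G \<phi> M \<longleftrightarrow>
     (\<forall>\<sigma>\<in>carrier G. \<phi> \<sigma> \<in> measurable M M \<and> distr M M (\<phi> \<sigma>) = M)"

definition empirical_measure :: "'a measure \<Rightarrow> nat \<Rightarrow> (nat \<Rightarrow> 'a) \<Rightarrow> 'a measure" where
  "empirical_measure M n x =
     measure_of (space M) (sets M) (\<lambda>A. (\<Sum>i<n. emeasure (return M (x i)) A) / of_nat n)"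

definition rkhs_ball :: "'h :: real_normed_vector set" where
  "rkhs_ball = {\<gamma>. norm \<gamma> \<le> 1}"

definition invariant_rkhs_ball ::
    "('g, 'm) monoid_scheme \<Rightarrow> 'a set \<Rightarrow> ('g \<Rightarrow> 'a \<Rightarrow> 'a) \<Rightarrow>
      ('h :: real_normed_vector \<Rightarrow> 'a \<Rightarrow> real) \<Rightarrow> 'h set" where
  "invariant_rkhs_ball G X \<phi> fun_of =
     {\<gamma> \<in> rkhs_ball. \<forall>\<sigma>\<in>carrier G. \<forall>x\<in>X. fun_of \<gamma> (\<phi> \<sigma> x) = fun_of \<gamma> x}"

text \<open>
  The supremum is the real-valued one, hence only meaningful when the set is bounded above; this is
  the case for a bounded kernel.
\<close>

definition MMD ::
    "('h :: real_normed_vector \<Rightarrow> 'a \<Rightarrow> real) \<Rightarrow> 'a measure \<Rightarrow> 'a measure \<Rightarrow> real" where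
  "MMD fun_of \<mu> \<nu> = (SUP \<gamma>\<in>rkhs_ball. (\<integral>x. fun_of \<gamma> x \<partial>\<mu>) - (\<integral>x. fun_of \<gamma> x \<partial>\<nu>))"

definition MMD_inv ::
    "('g, 'm) monoid_scheme \<Rightarrow> 'a set \<Rightarrow> ('g \<Rightarrow> 'a \<Rightarrow> 'a) \<Rightarrow>
      ('h :: real_normed_vector \<Rightarrow> 'a \<Rightarrow> real) \<Rightarrow> 'a measure \<Rightarrow> 'a measure \<Rightarrow> real" where
  "MMD_inv G X \<phi> fun_of \<mu> \<nu> =
     (SUP \<gamma>\<in>invariant_rkhs_ball G X \<phi> fun_of. (\<integral>x. fun_of \<gamma> x \<partial>\<mu>) - (\<integral>x. fun_of \<gamma> x \<partial>\<nu>))"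

text \<open>The joint law of \<open>m\<close> samples from \<open>P\<close> and \<open>n\<close> samples from \<open>Q\<close>, all independent.\<close>

definition sample_law ::
    "'a measure \<Rightarrow> 'a measure \<Rightarrow> nat \<Rightarrow> nat \<Rightarrow> ((nat \<Rightarrow> 'a) \<times> (nat \<Rightarrow> 'a)) measure" where
  "sample_law P Q m n = (\<Pi>\<^sub>M i\<in>{..<m}. P) \<Otimes>\<^sub>M (\<Pi>\<^sub>M j\<in>{..<n}. Q)"

end

theory Submission
  imports Defs
begin

text \<open>
  Let \<open>V = K (1 + c (|\<Sigma>| - 1)) / |\<Sigma>|\<close>. Represent evaluation at \<open>x\<close> by the kernel function \<open>feature x\<close> and let
  \<open>orbit_feature x\<close> be its average over the orbit of \<open>x\<close>. The discrepancy of \<open>P\<close> and \<open>Q\<close> is the norm \<open>\<parallel>\<mu> - \<nu>\<parallel>\<close> of the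
  difference of their mean embeddings (\<open>MMD_eq_norm_mean_difference\<close>). On invariant functions \<open>feature x\<close> can be
  replaced by \<open>orbit_feature x\<close>, which is itself invariant; hence the invariant discrepancy of the empirical measures is
  the norm of the difference of the two sample means of \<open>orbit_feature\<close> (\<open>MMD_inv_empirical_eq_norm\<close>). Because
  \<open>P\<close> and \<open>Q\<close> are invariant, these sample means have the expectations \<open>\<mu>\<close> and \<open>\<nu>\<close> (\<open>orbit_feature_mean\<close>). By the
  reverse triangle inequality the error in the theorem is therefore at most the norm \<open>D\<close> of a difference of two
  centred sample means.

  The gain from the symmetry is \<open>\<parallel>orbit_feature x\<parallel>\<^sup>2 \<le> V\<close> (\<open>norm_orbit_feature_le\<close>), whereas
  \<open>\<parallel>feature x\<parallel>\<^sup>2 = K\<close>. It controls \<open>D\<close> twice (\<open>two_sample_mean_concentration\<close>). The expectation of \<open>D\<close> is at most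
  \<open>sqrt V (1 / sqrt m + 1 / sqrt n)\<close> since the variances of independent summands add up
  (\<open>second_moment_sum\<close>). The deviation from the expectation is governed by McDiarmid's inequality
  (\<open>two_sample_bounded_differences_tail\<close>), as one sample point moves \<open>D\<close> by at most \<open>2 sqrt V / m\<close>
  or \<open>2 sqrt V / n\<close>. Together these give the claim for all nonempty samples.

  The Hilbert space need not be separable. Mean embeddings are therefore weak integrals, obtained from a Riesz
  representation (\<open>bounded_functional_represented_in_closure\<close>), and measurability of the norms has to be derived from
  that of the kernel (\<open>norm_mean_difference_measurable\<close>).
\<close>

section \<open>Hilbert spaces without coordinates\<close>

text \<open>
  Minimising \<open>\<parallel>f\<parallel>\<^sup>2 - 2 L f\<close> over \<open>S\<close> produces the Riesz representer of \<open>L\<close>. The subspace is allowed not to be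
  closed because two instances are wanted: \<open>S = UNIV\<close> yields the mean embedding of a measure, and \<open>S\<close> the
  span of the kernel functions yields their density, without a separate projection theorem.
\<close>

lemma bounded_functional_represented_in_closure:
  fixes L :: "'h :: {real_inner, complete_space} \<Rightarrow> real"
  assumes S: "subspace S"
    and add: "\<And>f g. f \<in> S \<Longrightarrow> g \<in> S \<Longrightarrow> L (f + g) = L f + L g"
    and scale: "\<And>a f. f \<in> S \<Longrightarrow> L (a *\<^sub>R f) = a * L f"
    and bound: "\<And>f. f \<in> S \<Longrightarrow> \<bar>L f\<bar> \<le> B * norm f"
  shows "\<exists>u\<in>closure S. \<forall>f\<in>S. L f = f \<bullet> u"
proof -
  define J where "J f = (norm f)\<^sup>2 - 2 * L f" for f
  define I where "I = Inf (J ` S)"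
  have S_add: "f + g \<in> S" if "f \<in> S" "g \<in> S" for f g
    using S that by (rule subspace_add)
  have S_scale: "a *\<^sub>R f \<in> S" if "f \<in> S" for a f
    using S that by (rule subspace_scale)
  have J_lower: "- B\<^sup>2 \<le> J f" if "f \<in> S" for f
  proof -
    have "0 \<le> (norm f - B)\<^sup>2" by simp
    then show ?thesis
      using bound[OF that] by (simp add: J_def power2_diff) (simp add: algebra_simps abs_le_iff)
  qed
  then have bdd: "bdd_below (J ` S)" by (intro bdd_belowI2)
  have I_le: "I \<le> J f" if "f \<in> S" for f
    unfolding I_def using bdd that by (intro cInf_lower) auto
  have "\<exists>f\<in>S. J f < I + 1 / real (Suc n)" for n
  proof -
    have "J ` S \<noteq> {}" using subspace_0[OF S] by auto
    then show ?thesis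
      using cInf_lessD[of "J ` S" "I + 1 / real (Suc n)"] by (auto simp: I_def)
  qed
  then obtain u where u_in: "\<And>n. u n \<in> S" and u_min: "\<And>n. J (u n) < I + 1 / real (Suc n)"
    by metis
  \<comment> \<open>The parallelogram law: the linear terms cancel, and the midpoint has \<open>J\<close>-value at least \<open>I\<close>, so a
    minimising sequence is Cauchy.\<close>
  have close: "(norm (u n - u m))\<^sup>2 \<le> 2 * (1 / real (Suc n)) + 2 * (1 / real (Suc m))" for n m
  proof -
    have mid: "(1/2) *\<^sub>R (u n + u m) \<in> S" by (intro S_scale S_add u_in)
    have J_mid: "J ((1/2) *\<^sub>R (u n + u m)) = (norm (u n + u m))\<^sup>2 / 4 - (L (u n) + L (u m))"
    proof -
      have L_mid: "L ((1/2) *\<^sub>R (u n + u m)) = 1/2 * (L (u n) + L (u m))"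
        by (simp only: scale[OF S_add[OF u_in u_in]] add[OF u_in u_in])
      have norm_mid: "(norm ((1/2) *\<^sub>R (u n + u m)))\<^sup>2 = (norm (u n + u m))\<^sup>2 / 4"
        by (simp only: norm_scaleR power_mult_distrib) (simp add: power_divide)
      have half: "2 * (1/2 * y) = y" for y :: real by simp
      show ?thesis unfolding J_def L_mid norm_mid half by (rule refl)
    qed
    have "(norm (u n - u m))\<^sup>2 + (norm (u n + u m))\<^sup>2 = 2 * (norm (u n))\<^sup>2 + 2 * (norm (u m))\<^sup>2"
      by (simp add: power2_norm_eq_inner inner_diff inner_add inner_commute)
    then show ?thesis
      using I_le[OF mid, unfolded J_mid] u_min[of n, unfolded J_def] u_min[of m, unfolded J_def]
      by linarith
  qed
  have "Cauchy u"
  proof (rule CauchyI)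
    fix e :: real assume "0 < e"
    obtain N where N: "4 / e\<^sup>2 < real N" using reals_Archimedean2 by blast
    have "norm (u n - u m) < e" if "N \<le> n" "N \<le> m" for n m
    proof -
      have "N \<noteq> 0" using N \<open>0 < e\<close> by (intro notI) (simp add: divide_less_0_iff)
      then have "2 * (1 / real (Suc n)) + 2 * (1 / real (Suc m)) \<le> 2 * (1 / real N) + 2 * (1 / real N)"
        using that by (intro add_mono mult_left_mono divide_left_mono) auto
      also have "\<dots> < e\<^sup>2" using N \<open>0 < e\<close> \<open>N \<noteq> 0\<close> by (simp add: field_simps)
      finally have "(norm (u n - u m))\<^sup>2 < e\<^sup>2" using close[of n m] by linarith
      then show ?thesis using \<open>0 < e\<close> by (rule power2_less_imp_less[OF _ less_imp_le])
    qed
    then show "\<exists>M. \<forall>m\<ge>M. \<forall>n\<ge>M. norm (u m - u n) < e" by blast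
  qed
  then obtain v where v: "u \<longlonglongrightarrow> v" using Cauchy_convergent convergent_def by blast
  have "L f = f \<bullet> v" if "f \<in> S" for f
  proof -
    define a where "a = f \<bullet> v - L f"
    \<comment> \<open>First-order condition at the minimiser: perturbing in the direction \<open>f\<close> cannot decrease \<open>J\<close>.\<close>
    have quadratic: "0 \<le> 2 * t * a + t\<^sup>2 * (norm f)\<^sup>2" for t
    proof -
      have step: "- (1 / real (Suc n)) \<le> 2 * t * (f \<bullet> u n - L f) + t\<^sup>2 * (norm f)\<^sup>2" for n
      proof -
        have "I \<le> J (u n + t *\<^sub>R f)" by (intro I_le S_add S_scale u_in that)
        also have "\<dots> = J (u n) + (2 * t * (f \<bullet> u n - L f) + t\<^sup>2 * (norm f)\<^sup>2)"
          by (simp add: J_def add S_scale scale u_in that power2_norm_eq_inner inner_add inner_commute)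
             (simp add: algebra_simps power2_eq_square)
        finally show ?thesis using u_min[of n] by simp
      qed
      have "(\<lambda>n. - (1 / real (Suc n))) \<longlonglongrightarrow> - 0"
        by (intro tendsto_minus LIMSEQ_Suc lim_1_over_n)
      moreover have "(\<lambda>n. 2 * t * (f \<bullet> u n - L f) + t\<^sup>2 * (norm f)\<^sup>2)
          \<longlonglongrightarrow> 2 * t * (f \<bullet> v - L f) + t\<^sup>2 * (norm f)\<^sup>2"
        by (intro tendsto_intros v)
      ultimately have "- 0 \<le> 2 * t * (f \<bullet> v - L f) + t\<^sup>2 * (norm f)\<^sup>2"
        by (rule LIMSEQ_le) (use step in blast)
      then show ?thesis by (simp add: a_def)
    qed
    have "a = 0"
    proof (cases "f = 0")
      case True
      then show ?thesis using scale[OF that, of 0] by (simp add: a_def)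
    next
      case False
      \<comment> \<open>The value of \<open>t\<close> that minimises the quadratic.\<close>
      have "0 \<le> - (a\<^sup>2 / (norm f)\<^sup>2)"
        using quadratic[of "- a / (norm f)\<^sup>2"] False
        by (simp add: power2_eq_square divide_simps)
      then show ?thesis using False by (simp add: divide_le_0_iff)
    qed
    then show ?thesis by (simp add: a_def)
  qed
  moreover have "v \<in> closure S" using u_in v closure_sequential by blast
  ultimately show ?thesis by blast
qed

text \<open>
  This turns both discrepancies into norms: the supremum of a linear functional over a part of the unit
  ball is the norm of its representer as soon as that part contains the normalised representer.
  For \<open>d = 0\<close> the convention \<open>sgn 0 = 0\<close> makes the hypothesis say \<open>0 \<in> S\<close>.
\<close>

lemma SUP_inner_eq_norm:
  fixes d :: "'h :: real_inner"
  assumes ball: "\<And>g. g \<in> S \<Longrightarrow> norm g \<le> 1" and "sgn d \<in> S"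
  shows "(SUP g\<in>S. g \<bullet> d) = norm d"
proof (rule cSup_eq_maximum)
  have "sgn d \<bullet> d = norm d"
    by (cases "d = 0") (simp_all add: sgn_div_norm dot_square_norm power2_eq_square)
  then show "norm d \<in> (\<lambda>g. g \<bullet> d) ` S" using assms(2) by force
  fix y assume "y \<in> (\<lambda>g. g \<bullet> d) ` S"
  then obtain g where g: "g \<in> S" "y = g \<bullet> d" by blast
  have "g \<bullet> d \<le> norm g * norm d" by (rule norm_cauchy_schwarz)
  also have "\<dots> \<le> 1 * norm d" by (intro mult_right_mono ball g) simp
  finally show "y \<le> norm d" using g by simp
qed

section \<open>Bounded differences\<close>

lemma abs_integral_le_bound:
  assumes "prob_space M" and [measurable]: "u \<in> borel_measurable M"
    and u: "\<And>x. x \<in> space M \<Longrightarrow> \<bar>u x\<bar> \<le> (B :: real)"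
  shows "\<bar>\<integral>x. u x \<partial>M\<bar> \<le> B"
proof -
  interpret prob_space M by fact
  have "\<bar>\<integral>x. u x \<partial>M\<bar> \<le> (\<integral>x. \<bar>u x\<bar> \<partial>M)" by (rule integral_abs_bound)
  also have "\<dots> \<le> B"
    using u by (intro integral_le_const) (auto intro!: AE_I2 integrable_const_bound[where B = B])
  finally show ?thesis .
qed

lemma integral_diff_bound:
  assumes "prob_space M"
    and [measurable]: "u \<in> borel_measurable M" "v \<in> borel_measurable M"
    and u: "\<And>x. x \<in> space M \<Longrightarrow> \<bar>u x\<bar> \<le> B" and v: "\<And>x. x \<in> space M \<Longrightarrow> \<bar>v x\<bar> \<le> B"
    and diff: "\<And>x. x \<in> space M \<Longrightarrow> \<bar>u x - v x\<bar> \<le> (c :: real)"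
  shows "\<bar>(\<integral>x. u x \<partial>M) - (\<integral>x. v x \<partial>M)\<bar> \<le> c"
proof -
  interpret prob_space M by fact
  have iu: "integrable M u" and iv: "integrable M v"
    using u v by (auto intro!: integrable_const_bound[where B = B] AE_I2)
  then have "\<bar>(\<integral>x. u x \<partial>M) - (\<integral>x. v x \<partial>M)\<bar> = \<bar>\<integral>x. u x - v x \<partial>M\<bar>" by simp
  also have "\<dots> \<le> (\<integral>x. \<bar>u x - v x\<bar> \<partial>M)" by (rule integral_abs_bound)
  also have "\<dots> \<le> c"
    using iu iv diff by (intro integral_le_const) (auto intro!: AE_I2)
  finally show ?thesis .
qed

text \<open>
  Hoeffding's lemma for a function about whose range only the width \<open>c\<close> is known: take its infimum as
  the left end of the interval.
\<close>

lemma mgf_bounded_oscillation: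
  assumes "prob_space M" and [measurable]: "f \<in> borel_measurable M"
    and bound: "\<And>x. x \<in> space M \<Longrightarrow> \<bar>f x\<bar> \<le> B"
    and osc: "\<And>x y. x \<in> space M \<Longrightarrow> y \<in> space M \<Longrightarrow> \<bar>f x - f y\<bar> \<le> c"
    and "(s :: real) > 0"
  shows "(\<integral>x. exp (s * (f x - (\<integral>y. f y \<partial>M))) \<partial>M) \<le> exp (s\<^sup>2 * c\<^sup>2 / 8)"
proof -
  interpret prob_space M by fact
  define a where "a = (INF x\<in>space M. f x)"
  have bdd: "bdd_below (f ` space M)"
    using bound by (intro bdd_belowI2[where m = "- B"]) (force simp: abs_le_iff)
  have range: "f x \<in> {a..a + c}" if "x \<in> space M" for x
  proof -
    have "f x - c \<le> a"
      unfolding a_def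
    proof (rule cINF_greatest[OF not_empty])
      show "f x - c \<le> f y" if "y \<in> space M" for y
        using osc[OF \<open>x \<in> space M\<close> that] by (simp add: abs_le_iff)
    qed
    moreover have "a \<le> f x" unfolding a_def by (rule cINF_lower[OF bdd that])
    ultimately show ?thesis by auto
  qed
  interpret interval_bounded_random_variable M f a "a + c"
    by unfold_locales (use range in \<open>auto intro!: AE_I2\<close>)
  have "(\<integral>\<^sup>+x. exp (s * (f x - expectation f)) \<partial>M) \<le> ennreal (exp (s\<^sup>2 * (a + c - a)\<^sup>2 / 8))"
    by (rule Hoeffdings_lemma_nn_integral[OF \<open>s > 0\<close>])
  then show ?thesis
    by (intro integral_real_bounded) (auto simp: )
qed

text \<open>
  The step by which sub-Gaussian bounds tensorise. With \<open>g x\<close> the conditional mean of \<open>F\<close> given \<open>x\<close>,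
  \<open>F - \<integral>g = (F - g) + (g - \<integral>g)\<close>; the exponential factorises, and the factor coming from \<open>g\<close> does not
  depend on \<open>y\<close>. Iterated integrals, rather than one over a product measure, let the same lemma serve for
  adding a coordinate to \<open>PiM\<close> and for pairing two samples.
\<close>

lemma mgf_iterated:
  fixes F :: "'a \<Rightarrow> 'b \<Rightarrow> real"
  assumes "prob_space N" "prob_space M"
    and [measurable]: "case_prod F \<in> borel_measurable (N \<Otimes>\<^sub>M M)"
    and bound: "\<And>x y. x \<in> space N \<Longrightarrow> y \<in> space M \<Longrightarrow> \<bar>F x y\<bar> \<le> B"
    and s: "s > 0" and "a \<ge> 0"
    and inner: "\<And>x. x \<in> space N \<Longrightarrow> (\<integral>y. exp (s * (F x y - (\<integral>z. F x z \<partial>M))) \<partial>M) \<le> a"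
    and outer: "(\<integral>x. exp (s * ((\<integral>z. F x z \<partial>M) - (\<integral>x. (\<integral>z. F x z \<partial>M) \<partial>N))) \<partial>N) \<le> b"
  shows "(\<integral>x. (\<integral>y. exp (s * (F x y - (\<integral>x. (\<integral>z. F x z \<partial>M) \<partial>N))) \<partial>M) \<partial>N) \<le> a * b"
proof -
  interpret N: prob_space N by fact
  interpret M: prob_space M by fact
  define g where "g x = (\<integral>z. F x z \<partial>M)" for x
  define e where "e = (\<integral>x. g x \<partial>N)"
  have [measurable]: "g \<in> borel_measurable N" unfolding g_def by measurable
  have Fx [measurable]: "F x \<in> borel_measurable M" if "x \<in> space N" for x
    using measurable_Pair2[OF assms(3) that] by simp
  have g_bound: "\<bar>g x\<bar> \<le> B" if "x \<in> space N" for x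
    unfolding g_def using Fx[OF that] bound[OF that]
    by (intro abs_integral_le_bound M.prob_space_axioms)
  have exp_bound: "\<bar>exp (s * (u - v))\<bar> \<le> exp (s * (B + \<bar>v\<bar>))" if "\<bar>u\<bar> \<le> B" for u v
    using that s by (auto simp: abs_le_iff)
  have ig: "integrable N (\<lambda>x. exp (s * (g x - e)))"
  proof (intro N.integrable_const_bound[where B = "exp (s * (B + \<bar>e\<bar>))"] AE_I2)
    fix x assume "x \<in> space N"
    from exp_bound[OF g_bound[OF this], of e]
    show "norm (exp (s * (g x - e))) \<le> exp (s * (B + \<bar>e\<bar>))" by simp
  qed measurable
  have iF: "integrable N (\<lambda>x. \<integral>y. exp (s * (F x y - e)) \<partial>M)"
  proof (intro N.integrable_const_bound[where B = "exp (s * (B + \<bar>e\<bar>))"] AE_I2)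
    fix x assume x: "x \<in> space N"
    have [measurable]: "F x \<in> borel_measurable M" by (rule Fx[OF x])
    have "\<bar>\<integral>y. exp (s * (F x y - e)) \<partial>M\<bar> \<le> exp (s * (B + \<bar>e\<bar>))"
      by (rule abs_integral_le_bound[OF M.prob_space_axioms _ exp_bound[OF bound[OF x]]]) measurable
    then show "norm (\<integral>y. exp (s * (F x y - e)) \<partial>M) \<le> exp (s * (B + \<bar>e\<bar>))"
      unfolding real_norm_def .
  qed measurable
  have "(\<integral>x. (\<integral>y. exp (s * (F x y - e)) \<partial>M) \<partial>N) \<le> (\<integral>x. a * exp (s * (g x - e)) \<partial>N)"
  proof (intro integral_mono iF integrable_mult_right ig)
    fix x assume x: "x \<in> space N"
    have "exp (s * (F x y - e)) = exp (s * (F x y - g x)) * exp (s * (g x - e))" for y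
      by (simp add: exp_add[symmetric] algebra_simps)
    then have "(\<integral>y. exp (s * (F x y - e)) \<partial>M)
        = (\<integral>y. exp (s * (F x y - g x)) \<partial>M) * exp (s * (g x - e))" by simp
    also have "\<dots> \<le> a * exp (s * (g x - e))"
      using inner[OF x] by (intro mult_right_mono) (auto simp: g_def)
    finally show "(\<integral>y. exp (s * (F x y - e)) \<partial>M) \<le> a * exp (s * (g x - e))" .
  qed
  also have "\<dots> \<le> a * b"
    using outer \<open>a \<ge> 0\<close> by (auto simp: g_def e_def intro!: mult_left_mono)
  finally show ?thesis by (simp add: g_def e_def)
qed

text \<open>
  The moment generating function behind McDiarmid's inequality. The coordinates are integrated out one
  at a time: the last one costs \<open>s\<^sup>2 (c i)\<^sup>2 / 8\<close> by Hoeffding's lemma, and averaging over it preserves the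
  bounded differences in all other coordinates, so the induction goes on with the average.
\<close>

lemma mgf_bounded_differences_PiM:
  fixes f :: "('i \<Rightarrow> 'a) \<Rightarrow> real"
  assumes prob: "prob_space P" and "finite I"
    and "f \<in> borel_measurable (PiM I (\<lambda>_. P))"
    and "\<And>w. w \<in> space (PiM I (\<lambda>_. P)) \<Longrightarrow> \<bar>f w\<bar> \<le> B"
    and "\<And>w i y. w \<in> space (PiM I (\<lambda>_. P)) \<Longrightarrow> i \<in> I \<Longrightarrow> y \<in> space P \<Longrightarrow> \<bar>f (w(i := y)) - f w\<bar> \<le> c i"
    and s: "s > 0"
  shows "(\<integral>w. exp (s * (f w - (\<integral>w. f w \<partial>PiM I (\<lambda>_. P)))) \<partial>PiM I (\<lambda>_. P))
    \<le> exp (s\<^sup>2 * (\<Sum>i\<in>I. (c i)\<^sup>2) / 8)"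
  using assms(2-5)
proof (induction I arbitrary: f rule: finite_induct)
  case empty
  interpret product_prob_space "\<lambda>_. P" by (intro product_prob_spaceI prob)
  show ?case by (simp add: PiM_empty lebesgue_integral_count_space_finite)
next
  case (insert i I)
  interpret product_prob_space "\<lambda>_. P" by (intro product_prob_spaceI prob)
  let ?M = "PiM I (\<lambda>_. P)" and ?M' = "PiM (insert i I) (\<lambda>_. P)"
  interpret N: prob_space ?M by (intro prob_space_PiM prob)
  interpret N': prob_space ?M' by (intro prob_space_PiM prob)
  note [measurable] = insert.prems(1)
  have ext: "w(i := y) \<in> space ?M'" if "w \<in> space ?M" "y \<in> space P" for w y
    using that by (auto simp: space_PiM PiE_iff extensional_def)
  have upd: "w(j := y) \<in> space ?M" if "w \<in> space ?M" "j \<in> I" "y \<in> space P" for w j y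
    using that by (auto simp: space_PiM PiE_iff extensional_def)
  define F where "F w y = f (w(i := y))" for w y
  define g where "g w = (\<integral>y. F w y \<partial>P)" for w
  have [measurable]: "case_prod F \<in> borel_measurable (?M \<Otimes>\<^sub>M P)"
    unfolding F_def by measurable
  have [measurable]: "g \<in> borel_measurable ?M" unfolding g_def by measurable
  have F1: "F w \<in> borel_measurable P" if "w \<in> space ?M" for w
    using measurable_Pair2[OF \<open>case_prod F \<in> _\<close> that] by simp
  have F_bound: "\<bar>F w y\<bar> \<le> B" if "w \<in> space ?M" "y \<in> space P" for w y
    unfolding F_def by (rule insert.prems(2)[OF ext[OF that]])
  have int_f: "integrable ?M' f"
    using insert.prems(2) by (intro N'.integrable_const_bound[where B = B] AE_I2) auto
  have mean: "(\<integral>w. f w \<partial>?M') = (\<integral>w. g w \<partial>?M)"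
    unfolding g_def F_def by (rule product_integral_insert[OF insert.hyps int_f])
  have "integrable ?M' (\<lambda>w. exp (s * (f w - e)))" for e
  proof (intro N'.integrable_const_bound[where B = "exp (s * (B - e))"] AE_I2)
    fix w assume "w \<in> space ?M'"
    from insert.prems(2)[OF this] show "norm (exp (s * (f w - e))) \<le> exp (s * (B - e))"
      using s by simp
  qed measurable
  then have "(\<integral>w. exp (s * (f w - (\<integral>w. f w \<partial>?M'))) \<partial>?M')
      = (\<integral>w. (\<integral>y. exp (s * (F w y - (\<integral>w. g w \<partial>?M))) \<partial>P) \<partial>?M)"
    unfolding mean F_def by (rule product_integral_insert[OF insert.hyps])
  also have "\<dots> \<le> exp (s\<^sup>2 * (c i)\<^sup>2 / 8) * exp (s\<^sup>2 * (\<Sum>i\<in>I. (c i)\<^sup>2) / 8)"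
    unfolding g_def
  proof (rule mgf_iterated[OF N.prob_space_axioms prob \<open>case_prod F \<in> _\<close> F_bound s])
    fix w assume w: "w \<in> space ?M"
    have "\<bar>F w x - F w y\<bar> \<le> c i" if "x \<in> space P" "y \<in> space P" for x y
      using insert.prems(3)[OF ext[OF w that(2)] insertI1 that(1), unfolded fun_upd_upd]
      unfolding F_def .
    then show "(\<integral>y. exp (s * (F w y - (\<integral>z. F w z \<partial>P))) \<partial>P) \<le> exp (s\<^sup>2 * (c i)\<^sup>2 / 8)"
      using F_bound[OF w] by (intro mgf_bounded_oscillation[OF prob F1[OF w] _ _ s, of B]) auto
  next
    have "(\<integral>w. exp (s * (g w - (\<integral>w. g w \<partial>?M))) \<partial>?M) \<le> exp (s\<^sup>2 * (\<Sum>i\<in>I. (c i)\<^sup>2) / 8)"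
    proof (rule insert.IH)
      fix w assume w: "w \<in> space ?M"
      show "\<bar>g w\<bar> \<le> B"
        unfolding g_def by (rule abs_integral_le_bound[OF prob F1[OF w] F_bound[OF w]])
    next
      fix w j y assume w: "w \<in> space ?M" and j: "j \<in> I" and y: "y \<in> space P"
      have "\<bar>F (w(j := y)) z - F w z\<bar> \<le> c j" if "z \<in> space P" for z
      proof -
        have "j \<noteq> i" using insert.hyps j by auto
        show ?thesis
          using insert.prems(3)[OF ext[OF w that] insertI2[OF j] y]
          unfolding F_def fun_upd_twist[OF \<open>j \<noteq> i\<close>] .
      qed
      then show "\<bar>g (w(j := y)) - g w\<bar> \<le> c j"
        unfolding g_def
        by (intro integral_diff_bound[OF prob F1[OF upd[OF w j y]] F1[OF w], of B] F_bound upd w j y)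
    qed measurable
    then show "(\<integral>w. exp (s * ((\<integral>z. F w z \<partial>P) - (\<integral>w. (\<integral>z. F w z \<partial>P) \<partial>?M))) \<partial>?M)
      \<le> exp (s\<^sup>2 * (\<Sum>i\<in>I. (c i)\<^sup>2) / 8)" by (simp add: g_def)
  qed auto
  also have "\<dots> = exp (s\<^sup>2 * (\<Sum>i\<in>insert i I. (c i)\<^sup>2) / 8)"
    using insert.hyps by (simp add: exp_add[symmetric] add_divide_distrib distrib_left)
  finally show ?case .
qed

text \<open>
  McDiarmid's inequality for a function of two independent samples with different laws, by Chernoff's
  bound.
\<close>

lemma two_sample_bounded_differences_tail:
  fixes f :: "('i \<Rightarrow> 'a) \<Rightarrow> ('j \<Rightarrow> 'b) \<Rightarrow> real"
    and I :: "'i set" and J :: "'j set" and P :: "'a measure" and Q :: "'b measure"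
  defines "PI \<equiv> PiM I (\<lambda>_. P)" and "QJ \<equiv> PiM J (\<lambda>_. Q)"
  assumes P: "prob_space P" and Q: "prob_space Q" and I: "finite I" and J: "finite J"
    and f [measurable]: "case_prod f \<in> borel_measurable (PI \<Otimes>\<^sub>M QJ)"
    and bound: "\<And>x y. x \<in> space (PI) \<Longrightarrow> y \<in> space (QJ) \<Longrightarrow> \<bar>f x y\<bar> \<le> B"
    and diff1: "\<And>x y i z. x \<in> space (PI) \<Longrightarrow> y \<in> space (QJ) \<Longrightarrow> i \<in> I \<Longrightarrow> z \<in> space P \<Longrightarrow>
      \<bar>f (x(i := z)) y - f x y\<bar> \<le> c i"
    and diff2: "\<And>x y j z. x \<in> space (PI) \<Longrightarrow> y \<in> space (QJ) \<Longrightarrow> j \<in> J \<Longrightarrow> z \<in> space Q \<Longrightarrow>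
      \<bar>f x (y(j := z)) - f x y\<bar> \<le> d j"
    and v: "(\<Sum>i\<in>I. (c i)\<^sup>2) + (\<Sum>j\<in>J. (d j)\<^sup>2) = v" "v > 0" and t: "t > 0"
  defines "M \<equiv> PI \<Otimes>\<^sub>M QJ"
  shows "measure M {w \<in> space M. (\<integral>w. case_prod f w \<partial>M) + t \<le> case_prod f w} \<le> exp (- 2 * t\<^sup>2 / v)"
proof -
  interpret PI: prob_space PI unfolding PI_def by (intro prob_space_PiM P)
  interpret QJ: prob_space QJ unfolding QJ_def by (rule prob_space_PiM) (rule Q)
  interpret M: pair_prob_space PI QJ ..
  interpret M: prob_space M unfolding M_def by (rule M.P.prob_space_axioms)
  have [measurable]: "case_prod f \<in> borel_measurable M" unfolding M_def by measurable
  define e where "e = (\<integral>w. case_prod f w \<partial>M)"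
  define g where "g x = (\<integral>y. f x y \<partial>QJ)" for x
  \<comment> \<open>The minimiser of the Chernoff exponent \<open>- s t + s\<^sup>2 v / 8\<close>.\<close>
  define s where "s = 4 * t / v"
  have s: "s > 0" using t v by (simp add: s_def)
  have f1: "f x \<in> borel_measurable (QJ)" if "x \<in> space (PI)" for x
    using measurable_Pair2[OF f that] by simp
  have g [measurable]: "g \<in> borel_measurable (PI)" unfolding g_def by measurable
  have f_bound: "\<bar>case_prod f w\<bar> \<le> B" if "w \<in> space M" for w
    using that bound by (auto simp: M_def space_pair_measure)
  have upd: "x(i := z) \<in> space (PI)" if "x \<in> space (PI)" "i \<in> I" "z \<in> space P" for x i z
    using that by (auto simp: PI_def space_PiM PiE_iff extensional_def)
  have int_f: "integrable M (case_prod f)"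
    using f_bound by (intro M.integrable_const_bound[where B = B] AE_I2) auto
  have e: "e = (\<integral>x. g x \<partial>PI)"
    using M.integral_fst'[OF int_f[unfolded M_def]] by (simp add: e_def g_def M_def)
  have int_exp: "integrable M (\<lambda>w. exp (s * (case_prod f w - e)))"
  proof (intro M.integrable_const_bound[where B = "exp (s * (B - e))"] AE_I2)
    fix w assume "w \<in> space M"
    from f_bound[OF this] show "norm (exp (s * (case_prod f w - e))) \<le> exp (s * (B - e))"
      using s by simp
  qed measurable
  have "(\<integral>w. exp (s * (case_prod f w - e)) \<partial>M)
      = (\<integral>x. (\<integral>y. exp (s * (f x y - (\<integral>x. g x \<partial>PI))) \<partial>QJ) \<partial>PI)"
    using M.integral_fst'[OF int_exp[unfolded M_def]] by (simp add: M_def e)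
  also have "\<dots> \<le> exp (s\<^sup>2 * (\<Sum>j\<in>J. (d j)\<^sup>2) / 8) * exp (s\<^sup>2 * (\<Sum>i\<in>I. (c i)\<^sup>2) / 8)"
    unfolding g_def
  proof (rule mgf_iterated[OF PI.prob_space_axioms QJ.prob_space_axioms f bound s])
    fix x assume x: "x \<in> space (PI)"
    show "(\<integral>y. exp (s * (f x y - (\<integral>z. f x z \<partial>QJ))) \<partial>QJ) \<le> exp (s\<^sup>2 * (\<Sum>j\<in>J. (d j)\<^sup>2) / 8)"
      using f1[OF x] bound[OF x] diff2[OF x] unfolding QJ_def
      by (intro mgf_bounded_differences_PiM[OF Q J _ _ _ s, of _ B]) auto
  next
    have "(\<integral>x. exp (s * (g x - (\<integral>x. g x \<partial>PI))) \<partial>PI) \<le> exp (s\<^sup>2 * (\<Sum>i\<in>I. (c i)\<^sup>2) / 8)"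
      unfolding PI_def
    proof (rule mgf_bounded_differences_PiM[OF P I _ _ _ s, where f = g and B = B and c = c], fold PI_def)
      fix x assume x: "x \<in> space (PI)"
      show "\<bar>g x\<bar> \<le> B"
        unfolding g_def by (rule abs_integral_le_bound[OF QJ.prob_space_axioms f1[OF x] bound[OF x]])
    next
      fix x i z assume x: "x \<in> space (PI)" and i: "i \<in> I" and z: "z \<in> space P"
      then show "\<bar>g (x(i := z)) - g x\<bar> \<le> c i"
        unfolding g_def
        by (intro integral_diff_bound[OF QJ.prob_space_axioms f1[OF upd[OF x i z]] f1[OF x], of B]
             bound diff1 upd)
    qed (rule g)
    then show "(\<integral>x. exp (s * ((\<integral>z. f x z \<partial>QJ) - (\<integral>x. (\<integral>z. f x z \<partial>QJ) \<partial>PI))) \<partial>PI)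
      \<le> exp (s\<^sup>2 * (\<Sum>i\<in>I. (c i)\<^sup>2) / 8)" by (simp add: g_def)
  qed auto
  also have "\<dots> = exp (s\<^sup>2 * v / 8)"
    unfolding v(1)[symmetric] by (simp add: exp_add[symmetric] distrib_left add_divide_distrib)
  finally have mgf: "(\<integral>w. exp (s * (case_prod f w - e)) \<partial>M) \<le> exp (s\<^sup>2 * v / 8)" .
  have "measure M {w \<in> space M. e + t \<le> case_prod f w}
      = measure M {w \<in> space M. t \<le> case_prod f w - e}" by (simp add: algebra_simps)
  also have "\<dots> \<le> exp (- s * t) * (\<integral>w\<in>space M. exp (s * (case_prod f w - e)) \<partial>M)"
    using s
  proof (rule M.Chernoff_ineq_ge)
    show "set_integrable M (space M) (\<lambda>w. exp (s * (case_prod f w - e)))"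
      unfolding set_integrable_def using int_exp by (intro integrable_mult_indicator) auto
  qed simp
  also have "(\<integral>w\<in>space M. exp (s * (case_prod f w - e)) \<partial>M) = (\<integral>w. exp (s * (case_prod f w - e)) \<partial>M)"
    using int_exp by (rule set_integral_space)
  also have "exp (- s * t) * \<dots> \<le> exp (- s * t) * exp (s\<^sup>2 * v / 8)"
    using mgf by (intro mult_left_mono) auto
  also have "\<dots> = exp (- s * t + s\<^sup>2 * v / 8)" by (simp only: exp_add)
  also have "- s * t + s\<^sup>2 * v / 8 = - 2 * t\<^sup>2 / v"
    using v(2) by (simp add: s_def power2_eq_square field_simps)
  finally show ?thesis by (simp add: e_def)
qed

section \<open>Means of independent random vectors\<close>

lemma sum_fun_upd_diff:
  fixes g :: "'a \<Rightarrow> 'b :: ab_group_add"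
  assumes "finite I" "i \<in> I"
  shows "(\<Sum>j\<in>I. g ((x(i := z)) j)) - (\<Sum>j\<in>I. g (x j)) = g z - g (x i)"
proof -
  have "(\<Sum>j\<in>I - {i}. g ((x(i := z)) j)) = (\<Sum>j\<in>I - {i}. g (x j))"
    by (rule sum.cong) auto
  then show ?thesis using assms by (simp add: sum.remove[of I i])
qed

lemma (in prob_space) expectation_le_root_mean_square:
  assumes "integrable M u" "integrable M (\<lambda>x. (u x)\<^sup>2)" and "(\<integral>x. (u x)\<^sup>2 \<partial>M) \<le> (v :: real)"
  shows "(\<integral>x. u x \<partial>M) \<le> sqrt v"
proof -
  have "(\<integral>x. u x \<partial>M)\<^sup>2 \<le> (\<integral>x. (u x)\<^sup>2 \<partial>M)"
    using variance_positive[of u] variance_eq[OF assms(1,2)] by simp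
  then show ?thesis using assms(3) by (intro real_le_rsqrt) linarith
qed

lemma norm_sum_measurable_if_inner_measurable:
  fixes \<xi> :: "'a \<Rightarrow> 'h :: real_inner"
  assumes inner: "(\<lambda>(x, y). \<xi> x \<bullet> \<xi> y) \<in> borel_measurable (P \<Otimes>\<^sub>M P)"
  shows "(\<lambda>x. norm (\<Sum>i\<in>I. \<xi> (x i))) \<in> borel_measurable (PiM I (\<lambda>_. P))"
proof -
  have "(\<lambda>x. \<xi> (x i) \<bullet> \<xi> (x j)) \<in> borel_measurable (PiM I (\<lambda>_. P))"
    if "i \<in> I" "j \<in> I" for i j
    using measurable_compose[OF measurable_Pair[OF measurable_component_singleton[OF that(1)]
        measurable_component_singleton[OF that(2)]] inner] by simp
  then show ?thesis
    unfolding norm_eq_sqrt_inner inner_sum_left inner_sum_right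
    by (intro measurable_compose[OF _ borel_measurable_sqrt] borel_measurable_sum) auto
qed

text \<open>
  A norm of a weakly measurable vector need not be measurable; here it is because its square expands into
  finitely many inner products of pairs of sample points.
\<close>

lemma norm_mean_difference_measurable:
  fixes \<xi> \<eta> :: "'a \<Rightarrow> 'h :: real_inner"
  assumes \<xi>: "(\<lambda>(x, y). \<xi> x \<bullet> \<xi> y) \<in> borel_measurable (P \<Otimes>\<^sub>M P)"
    and \<eta>: "(\<lambda>(x, y). \<eta> x \<bullet> \<eta> y) \<in> borel_measurable (Q \<Otimes>\<^sub>M Q)"
    and cross: "(\<lambda>(x, y). \<xi> x \<bullet> \<eta> y) \<in> borel_measurable (P \<Otimes>\<^sub>M Q)"
  shows "(\<lambda>(x, y). norm ((1 / real m) *\<^sub>R (\<Sum>i<m. \<xi> (x i)) - (1 / real n) *\<^sub>R (\<Sum>j<n. \<eta> (y j))))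
    \<in> borel_measurable (sample_law P Q m n)"
proof -
  let ?M = "sample_law P Q m n"
  define a where "a x = norm (\<Sum>i<m. \<xi> (x i)) / real m" for x
  define b where "b y = norm (\<Sum>j<n. \<eta> (y j)) / real n" for y
  define p where "p w = (\<Sum>i<m. \<Sum>j<n. \<xi> (fst w i) \<bullet> \<eta> (snd w j))" for w
  note [measurable] = norm_sum_measurable_if_inner_measurable[OF \<xi>, of "{..<m}"]
    norm_sum_measurable_if_inner_measurable[OF \<eta>, of "{..<n}"]
  have [measurable]: "(\<lambda>w. a (fst w)) \<in> borel_measurable ?M" "(\<lambda>w. b (snd w)) \<in> borel_measurable ?M"
    unfolding a_def b_def sample_law_def by measurable
  have "(\<lambda>w. \<xi> (fst w i) \<bullet> \<eta> (snd w j)) \<in> borel_measurable ?M" if "i < m" "j < n" for i j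
  proof -
    have "(\<lambda>w. (fst w i, snd w j)) \<in> measurable ?M (P \<Otimes>\<^sub>M Q)"
      unfolding sample_law_def using that
      by (intro measurable_Pair measurable_compose[OF measurable_fst measurable_component_singleton]
          measurable_compose[OF measurable_snd measurable_component_singleton]) auto
    from measurable_compose[OF this cross] show ?thesis by simp
  qed
  then have [measurable]: "p \<in> borel_measurable ?M"
    unfolding p_def by (intro borel_measurable_sum) auto
  have "norm ((1 / real m) *\<^sub>R (\<Sum>i<m. \<xi> (fst w i)) - (1 / real n) *\<^sub>R (\<Sum>j<n. \<eta> (snd w j)))
      = sqrt ((a (fst w))\<^sup>2 - 2 / (real m * real n) * p w + (b (snd w))\<^sup>2)" for w
    unfolding a_def b_def p_def norm_eq_sqrt_inner[of "_ - _"]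
    by (simp add: inner_diff inner_sum_left inner_sum_right inner_commute power_divide power2_norm_eq_inner
         power2_eq_square[of "real _"])
  then show ?thesis by (simp add: case_prod_beta')
qed

text \<open>
  Random vectors in a Hilbert space that need not be separable: the discrete kernel, which vanishes off
  the diagonal and is constant on it, is measurable, but its Hilbert space on an uncountable set is not
  separable. A Bochner integral of \<open>\<xi>\<close> therefore need not exist, and both measurability and the vanishing
  of the mean are imposed weakly, through inner products. The bound \<open>2 * sqrt V\<close> on the oscillation is the
  diameter of the ball that contains all values of \<open>\<xi>\<close> in the application.
\<close>

locale centred_vector = prob_space P for P :: "'a measure" +
  fixes \<xi> :: "'a \<Rightarrow> 'h :: real_inner" and V :: real
  assumes inner_measurable: "(\<lambda>(x, y). \<xi> x \<bullet> \<xi> y) \<in> borel_measurable (P \<Otimes>\<^sub>M P)"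
    and weakly_measurable: "\<And>v. (\<lambda>x. v \<bullet> \<xi> x) \<in> borel_measurable P"
    and centred: "\<And>v. (\<integral>x. v \<bullet> \<xi> x \<partial>P) = 0"
    and oscillation: "\<And>x y. x \<in> space P \<Longrightarrow> y \<in> space P \<Longrightarrow> norm (\<xi> x - \<xi> y) \<le> 2 * sqrt V"
    and second_moment: "(\<integral>x. (norm (\<xi> x))\<^sup>2 \<partial>P) \<le> V"
begin

lemma bounded: "\<exists>B. \<forall>x\<in>space P. norm (\<xi> x) \<le> B"
proof -
  obtain z where z: "z \<in> space P" using not_empty by blast
  have "norm (\<xi> x) \<le> norm (\<xi> z) + 2 * sqrt V" if "x \<in> space P" for x
    using norm_triangle_sub[of "\<xi> x" "\<xi> z"] oscillation[OF that z] by linarith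
  then show ?thesis by blast
qed

lemmas norm_sum_measurable = norm_sum_measurable_if_inner_measurable[OF inner_measurable]

lemma norm_sum_bounded:
  "\<exists>B. \<forall>x\<in>space (PiM I (\<lambda>_. P)). norm (\<Sum>i\<in>I. \<xi> (x i)) \<le> B"
proof -
  obtain B where B: "\<And>x. x \<in> space P \<Longrightarrow> norm (\<xi> x) \<le> B" using bounded by blast
  have "norm (\<Sum>i\<in>I. \<xi> (x i)) \<le> (\<Sum>i\<in>I. B)" if "x \<in> space (PiM I (\<lambda>_. P))" for x
    using that by (intro sum_norm_le B) (auto simp: space_PiM)
  then show ?thesis by blast
qed

lemma integrable_norm_sum:
  "integrable (PiM I (\<lambda>_. P)) (\<lambda>x. norm (\<Sum>i\<in>I. \<xi> (x i)))"
  "integrable (PiM I (\<lambda>_. P)) (\<lambda>x. (norm (\<Sum>i\<in>I. \<xi> (x i)))\<^sup>2)"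
proof -
  interpret N: prob_space "PiM I (\<lambda>_. P)" by (intro prob_space_PiM prob_space_axioms)
  note [measurable] = norm_sum_measurable[of I]
  obtain B where B: "\<And>x. x \<in> space (PiM I (\<lambda>_. P)) \<Longrightarrow> norm (\<Sum>i\<in>I. \<xi> (x i)) \<le> B"
    using norm_sum_bounded[of I] by blast
  then show "integrable (PiM I (\<lambda>_. P)) (\<lambda>x. norm (\<Sum>i\<in>I. \<xi> (x i)))"
    by (intro N.integrable_const_bound[where B = B] AE_I2) auto
  show "integrable (PiM I (\<lambda>_. P)) (\<lambda>x. (norm (\<Sum>i\<in>I. \<xi> (x i)))\<^sup>2)"
    using B by (intro N.integrable_const_bound[where B = "B\<^sup>2"] AE_I2) (auto intro: power_mono)
qed

text \<open>
  Independence enters by integrating out one new coordinate \<open>y\<close> for fixed \<open>S\<close>, the sum over the old ones: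
  the mixed term \<open>S \<bullet> \<xi> y\<close> has mean zero.
\<close>

lemma second_moment_sum:
  assumes "finite I"
  shows "(\<integral>x. (norm (\<Sum>i\<in>I. \<xi> (x i)))\<^sup>2 \<partial>PiM I (\<lambda>_. P)) \<le> real (card I) * V"
  using assms
proof (induction I rule: finite_induct)
  case empty
  show ?case by simp
next
  case (insert i I)
  interpret prod: product_prob_space "\<lambda>_. P" by (intro product_prob_spaceI prob_space_axioms)
  interpret N: prob_space "PiM I (\<lambda>_. P)" by (intro prob_space_PiM prob_space_axioms)
  obtain B where B: "\<And>x. x \<in> space P \<Longrightarrow> norm (\<xi> x) \<le> B" using bounded by blast
  define S where "S x = (\<Sum>j\<in>I. \<xi> (x j))" for x
  define V0 where "V0 = (\<integral>x. (norm (\<xi> x))\<^sup>2 \<partial>P)"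
  have int_sq: "integrable P (\<lambda>x. (norm (\<xi> x))\<^sup>2)"
  proof (intro integrable_const_bound[where B = "B\<^sup>2"] AE_I2)
    have "(\<lambda>x. \<xi> x \<bullet> \<xi> x) \<in> borel_measurable P"
      using measurable_compose[OF measurable_Pair[OF measurable_ident measurable_ident] inner_measurable]
      by simp
    then show "(\<lambda>x. (norm (\<xi> x))\<^sup>2) \<in> borel_measurable P" by (simp add: power2_norm_eq_inner)
  qed (use B in \<open>auto intro: power_mono\<close>)
  have int_inner: "integrable P (\<lambda>x. v \<bullet> \<xi> x)" for v
  proof (intro integrable_const_bound[where B = "norm v * B"] AE_I2 weakly_measurable)
    fix x assume "x \<in> space P"
    then show "norm (v \<bullet> \<xi> x) \<le> norm v * B"
      using Cauchy_Schwarz_ineq2[of v "\<xi> x"] mult_left_mono[OF B, of x "norm v"] by simp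
  qed
  have "(\<integral>x. (norm (\<Sum>j\<in>insert i I. \<xi> (x j)))\<^sup>2 \<partial>PiM (insert i I) (\<lambda>_. P))
      = (\<integral>x. (\<integral>y. (norm (\<Sum>j\<in>insert i I. \<xi> ((x(i := y)) j)))\<^sup>2 \<partial>P) \<partial>PiM I (\<lambda>_. P))"
    by (rule prod.product_integral_insert[OF insert.hyps integrable_norm_sum(2)])
  also have "\<dots> = (\<integral>x. V0 + (norm (S x))\<^sup>2 \<partial>PiM I (\<lambda>_. P))"
  proof (rule Bochner_Integration.integral_cong[OF refl])
    fix x
    have "(\<Sum>j\<in>insert i I. \<xi> ((x(i := y)) j)) = \<xi> y + S x" for y
    proof -
      have "(\<Sum>j\<in>I. \<xi> ((x(i := y)) j)) = S x"
        unfolding S_def using insert.hyps by (intro sum.cong) auto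
      then show ?thesis using insert.hyps by simp
    qed
    moreover have "(norm (\<xi> y + S x))\<^sup>2 = (norm (\<xi> y))\<^sup>2 + 2 * (S x \<bullet> \<xi> y) + (norm (S x))\<^sup>2" for y
      by (simp add: power2_norm_eq_inner inner_add inner_commute)
    ultimately show "(\<integral>y. (norm (\<Sum>j\<in>insert i I. \<xi> ((x(i := y)) j)))\<^sup>2 \<partial>P) = V0 + (norm (S x))\<^sup>2"
      using int_sq int_inner by (simp add: V0_def centred prob_space)
  qed
  also have "\<dots> = V0 + (\<integral>x. (norm (S x))\<^sup>2 \<partial>PiM I (\<lambda>_. P))"
    using integrable_norm_sum(2)[of I] by (simp add: S_def N.prob_space)
  also have "\<dots> \<le> real (card (insert i I)) * V"
    using insert second_moment by (simp add: V0_def S_def distrib_right)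
  finally show ?case .
qed

lemma expected_norm_mean:
  assumes "m > 0"
  shows "(\<integral>x. norm (\<Sum>i<m. \<xi> (x i)) / real m \<partial>PiM {..<m} (\<lambda>_. P)) \<le> sqrt V / sqrt (real m)"
proof -
  interpret N: prob_space "PiM {..<m} (\<lambda>_. P)" by (intro prob_space_PiM prob_space_axioms)
  have "(\<integral>x. norm (\<Sum>i<m. \<xi> (x i)) \<partial>PiM {..<m} (\<lambda>_. P)) \<le> sqrt (real m * V)"
    using second_moment_sum[of "{..<m}"]
    by (intro N.expectation_le_root_mean_square integrable_norm_sum) auto
  then have "(\<integral>x. norm (\<Sum>i<m. \<xi> (x i)) \<partial>PiM {..<m} (\<lambda>_. P)) / real m \<le> sqrt (real m * V) / real m"
    by (rule divide_right_mono) simp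
  also have "\<dots> = sqrt V / sqrt (real m)"
    using assms by (simp add: real_sqrt_mult real_div_sqrt field_simps)
  finally show ?thesis by simp
qed

end

text \<open>
  By the second moment bound, the expectation of the norm \<open>D\<close> of the difference of the two sample means
  is at most \<open>sqrt V (1 / sqrt m + 1 / sqrt n)\<close>, and replacing one sample point
  moves \<open>D\<close> by at most \<open>2 sqrt V / m\<close> or \<open>2 sqrt V / n\<close>. The sum of the squares of these differences is
  \<open>4 V (1 / m + 1 / n)\<close>, so that McDiarmid's exponent at the chosen deviation is exactly \<open>ln \<epsilon>\<close>.
\<close>

lemma two_sample_mean_concentration:
  fixes \<xi> \<eta> :: "'a \<Rightarrow> 'h :: real_inner"
  assumes \<xi>: "centred_vector P \<xi> V" and \<eta>: "centred_vector Q \<eta> V"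
    and cross: "(\<lambda>(x, y). \<xi> x \<bullet> \<eta> y) \<in> borel_measurable (P \<Otimes>\<^sub>M Q)"
    and "V > 0" "m > 0" "n > 0" "0 < \<epsilon>" "\<epsilon> < 1"
  defines "D \<equiv> \<lambda>x y. norm ((1 / real m) *\<^sub>R (\<Sum>i<m. \<xi> (x i)) - (1 / real n) *\<^sub>R (\<Sum>j<n. \<eta> (y j)))"
  shows "measure (sample_law P Q m n) {w \<in> space (sample_law P Q m n).
      sqrt V * (1 / sqrt (real m) + 1 / sqrt (real n))
        + sqrt (2 * V * ln (1 / \<epsilon>)) * sqrt (1 / real m + 1 / real n) \<le> case_prod D w} \<le> \<epsilon>"
proof -
  interpret P: centred_vector P \<xi> V by fact
  interpret Q: centred_vector Q \<eta> V by fact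
  let ?P = "PiM {..<m} (\<lambda>_. P)" and ?Q = "PiM {..<n} (\<lambda>_. Q)"
  define M where "M = ?P \<Otimes>\<^sub>M ?Q"
  have law: "sample_law P Q m n = M" by (simp add: sample_law_def M_def)
  interpret PP: prob_space ?P by (intro prob_space_PiM P.prob_space_axioms)
  interpret QQ: prob_space ?Q by (intro prob_space_PiM Q.prob_space_axioms)
  interpret pair: pair_prob_space ?P ?Q ..
  interpret M: prob_space M unfolding M_def by (rule pair.P.prob_space_axioms)
  define a where "a x = norm (\<Sum>i<m. \<xi> (x i)) / real m" for x
  define b where "b y = norm (\<Sum>j<n. \<eta> (y j)) / real n" for y
  note [measurable] = P.norm_sum_measurable[of "{..<m}"] Q.norm_sum_measurable[of "{..<n}"]
  have [measurable]: "a \<in> borel_measurable ?P" "b \<in> borel_measurable ?Q"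
    unfolding a_def b_def by measurable
  have D [measurable]: "case_prod D \<in> borel_measurable M"
    unfolding D_def law[symmetric]
    by (rule norm_mean_difference_measurable[OF P.inner_measurable Q.inner_measurable cross])
  have D_le: "D x y \<le> a x + b y" for x y
    unfolding D_def a_def b_def by (rule order_trans[OF norm_triangle_ineq4]) simp
  obtain A where A: "\<And>x. x \<in> space ?P \<Longrightarrow> a x \<le> A"
    using P.norm_sum_bounded[of "{..<m}"] unfolding a_def
    by (metis divide_right_mono of_nat_0_le_iff)
  obtain B where B: "\<And>y. y \<in> space ?Q \<Longrightarrow> b y \<le> B"
    using Q.norm_sum_bounded[of "{..<n}"] unfolding b_def
    by (metis divide_right_mono of_nat_0_le_iff)
  have D_nonneg: "0 \<le> D x y" for x y by (simp add: D_def)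
  have D_bound: "\<bar>D x y\<bar> \<le> A + B" if "x \<in> space ?P" "y \<in> space ?Q" for x y
    using D_nonneg[of x y] D_le[of x y] A[OF that(1)] B[OF that(2)] by linarith
  have int_a: "integrable ?P a" and int_b: "integrable ?Q b"
    unfolding a_def b_def by (auto intro!: P.integrable_norm_sum Q.integrable_norm_sum)
  have int_ab: "integrable M (\<lambda>w. a (fst w) + b (snd w))"
  proof (intro M.integrable_const_bound[where B = "A + B"] AE_I2)
    fix w assume "w \<in> space M"
    then have "a (fst w) \<le> A" "b (snd w) \<le> B"
      by (auto simp: M_def space_pair_measure intro: A B)
    moreover have "0 \<le> a (fst w)" "0 \<le> b (snd w)" by (auto simp: a_def b_def)
    ultimately show "norm (a (fst w) + b (snd w)) \<le> A + B" by simp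
  qed (unfold M_def, measurable)
  have "(\<integral>w. case_prod D w \<partial>M) \<le> (\<integral>w. a (fst w) + b (snd w) \<partial>M)"
  proof (rule integral_mono[OF _ int_ab])
    show "integrable M (case_prod D)"
      using D_bound by (intro M.integrable_const_bound[where B = "A + B"] AE_I2 D)
        (auto simp: M_def space_pair_measure)
  qed (use D_le in \<open>auto simp: case_prod_beta\<close>)
  also have "\<dots> = (\<integral>x. (\<integral>y. a x + b y \<partial>?Q) \<partial>?P)"
    using pair.integral_fst'[OF int_ab[unfolded M_def]] by (simp add: M_def)
  also have "\<dots> = (\<integral>x. a x \<partial>?P) + (\<integral>y. b y \<partial>?Q)"
    using int_a int_b by (simp add: PP.prob_space QQ.prob_space)
  also have "\<dots> \<le> sqrt V / sqrt (real m) + sqrt V / sqrt (real n)"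
    unfolding a_def b_def by (intro add_mono P.expected_norm_mean Q.expected_norm_mean assms)
  also have "\<dots> = sqrt V * (1 / sqrt (real m) + 1 / sqrt (real n))" by (simp add: distrib_left)
  finally have mean: "(\<integral>w. case_prod D w \<partial>M) \<le> sqrt V * (1 / sqrt (real m) + 1 / sqrt (real n))" .
  define h where "h = 1 / real m + 1 / real n"
  define t where "t = sqrt (2 * V * ln (1 / \<epsilon>)) * sqrt h"
  have h: "h > 0" using assms by (simp add: h_def add_pos_pos)
  have ln_pos: "ln (1 / \<epsilon>) > 0" using assms by simp
  have t: "t > 0" unfolding t_def using h ln_pos \<open>V > 0\<close> by simp
  have t_sq: "t\<^sup>2 = 2 * V * ln (1 / \<epsilon>) * h"
    unfolding t_def using h ln_pos \<open>V > 0\<close> by (simp add: power_mult_distrib)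
  have "measure M {w \<in> space M. (\<integral>w. case_prod D w \<partial>M) + t \<le> case_prod D w} \<le> exp (- 2 * t\<^sup>2 / (4 * V * h))"
    unfolding M_def
  proof (rule two_sample_bounded_differences_tail[OF P.prob_space_axioms Q.prob_space_axioms _ _ _ _ _ _ _ _ t,
        where c = "\<lambda>_. 2 * sqrt V / real m" and d = "\<lambda>_. 2 * sqrt V / real n" and B = "A + B"])
    show "case_prod D \<in> borel_measurable (?P \<Otimes>\<^sub>M ?Q)" using D by (simp add: M_def)
  next
    fix x y i z assume x: "x \<in> space ?P" and i: "i \<in> {..<m}" and z: "z \<in> space P"
    have "\<bar>D (x(i := z)) y - D x y\<bar>
        \<le> norm ((1 / real m) *\<^sub>R ((\<Sum>i'<m. \<xi> ((x(i := z)) i')) - (\<Sum>i'<m. \<xi> (x i'))))"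
      unfolding D_def by (rule order_trans[OF norm_triangle_ineq3]) (simp add: scaleR_diff_right)
    also have "\<dots> = norm (\<xi> z - \<xi> (x i)) / real m"
      using i by (simp only: sum_fun_upd_diff[OF finite_lessThan i]) simp
    also have "\<dots> \<le> 2 * sqrt V / real m"
      using x i z by (intro divide_right_mono P.oscillation) (auto simp: space_PiM)
    finally show "\<bar>D (x(i := z)) y - D x y\<bar> \<le> 2 * sqrt V / real m" .
  next
    fix x y j z assume y: "y \<in> space ?Q" and j: "j \<in> {..<n}" and z: "z \<in> space Q"
    have "\<bar>D x (y(j := z)) - D x y\<bar>
        \<le> norm ((1 / real n) *\<^sub>R ((\<Sum>j'<n. \<eta> ((y(j := z)) j')) - (\<Sum>j'<n. \<eta> (y j'))))"
      unfolding D_def norm_minus_commute[of "(1 / real m) *\<^sub>R _"]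
      by (rule order_trans[OF norm_triangle_ineq3]) (simp add: scaleR_diff_right)
    also have "\<dots> = norm (\<eta> z - \<eta> (y j)) / real n"
      by (simp only: sum_fun_upd_diff[OF finite_lessThan j]) simp
    also have "\<dots> \<le> 2 * sqrt V / real n"
      using y j z by (intro divide_right_mono Q.oscillation) (auto simp: space_PiM)
    finally show "\<bar>D x (y(j := z)) - D x y\<bar> \<le> 2 * sqrt V / real n" .
  next
    show "(\<Sum>i<m. (2 * sqrt V / real m)\<^sup>2) + (\<Sum>j<n. (2 * sqrt V / real n)\<^sup>2) = 4 * V * h"
      using assms by (simp add: h_def power_divide power_mult_distrib power2_eq_square distrib_left)
    show "0 < 4 * V * h" using h \<open>V > 0\<close> by simp
  qed (use D_bound in auto)
  also have "- 2 * t\<^sup>2 / (4 * V * h) = - ln (1 / \<epsilon>)"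
    unfolding t_sq using h \<open>V > 0\<close> by simp
  also have "exp (- ln (1 / \<epsilon>)) = \<epsilon>" using assms by (simp add: exp_minus)
  finally have tail: "measure M {w \<in> space M. (\<integral>w. case_prod D w \<partial>M) + t \<le> case_prod D w} \<le> \<epsilon>" .
  show "measure (sample_law P Q m n) {w \<in> space (sample_law P Q m n).
      sqrt V * (1 / sqrt (real m) + 1 / sqrt (real n))
        + sqrt (2 * V * ln (1 / \<epsilon>)) * sqrt (1 / real m + 1 / real n) \<le> case_prod D w} \<le> \<epsilon>"
    unfolding law
  proof (rule order_trans[OF M.finite_measure_mono tail])
    show "{w \<in> space M. sqrt V * (1 / sqrt (real m) + 1 / sqrt (real n))
        + sqrt (2 * V * ln (1 / \<epsilon>)) * sqrt (1 / real m + 1 / real n) \<le> case_prod D w}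
      \<subseteq> {w \<in> space M. (\<integral>w. case_prod D w \<partial>M) + t \<le> case_prod D w}"
      using mean unfolding t_def h_def by auto
  qed measurable
qed

section \<open>Mean embeddings\<close>

locale rkhs =
  fixes X :: "'a set" and fun_of :: "'h :: {real_inner, complete_space} \<Rightarrow> 'a \<Rightarrow> real"
    and k :: "'a \<Rightarrow> 'a \<Rightarrow> real"
  assumes rkhs: "rkhs_on X fun_of k"
begin

text \<open>
  The representer of evaluation at \<open>x\<close>, unique for \<open>x \<in> X\<close>; as a function on \<open>X\<close> it is the kernel
  function \<open>k(\<cdot>, x)\<close>.
\<close>

definition feature :: "'a \<Rightarrow> 'h" where
  "feature x = (SOME h. (\<forall>y\<in>X. fun_of h y = k y x) \<and> (\<forall>f. fun_of f x = f \<bullet> h))"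

lemma feature:
  assumes "x \<in> X"
  shows "\<forall>y\<in>X. fun_of (feature x) y = k y x" and "fun_of f x = f \<bullet> feature x"
proof -
  have "\<forall>x\<in>X. \<exists>h. (\<forall>y\<in>X. fun_of h y = k y x) \<and> (\<forall>f. fun_of f x = f \<bullet> h)"
    using rkhs unfolding rkhs_on_def by (elim conjE)
  note * = someI_ex[OF bspec[OF this assms], folded feature_def]
  show "\<forall>y\<in>X. fun_of (feature x) y = k y x" by (rule conjunct1[OF *])
  show "fun_of f x = f \<bullet> feature x" by (rule spec[OF conjunct2[OF *]])
qed

lemma inner_feature: "x \<in> X \<Longrightarrow> y \<in> X \<Longrightarrow> feature x \<bullet> feature y = k x y"
  using feature(1)[of y] feature(2)[of x "feature y"] by (simp add: inner_commute)

lemma eq_if_inner_feature_eq: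
  assumes "\<And>x. x \<in> X \<Longrightarrow> f \<bullet> feature x = g \<bullet> feature x"
  shows "f = g"
proof -
  have "\<forall>x\<in>X. fun_of f x = fun_of g x" using assms by (simp add: feature(2))
  moreover have "\<forall>f g. (\<forall>x\<in>X. fun_of f x = fun_of g x) \<longrightarrow> f = g"
    using rkhs unfolding rkhs_on_def by (elim conjE)
  ultimately show ?thesis by simp
qed

text \<open>
  The functional \<open>f \<bullet> _\<close> on the span has a representer \<open>u\<close> in the closure of the span. Then \<open>f\<close> and \<open>u\<close> have
  the same values on \<open>X\<close>, hence are equal.
\<close>

lemma features_dense: "f \<in> closure (span (feature ` X))"
proof -
  have "\<exists>u\<in>closure (span (feature ` X)). \<forall>g\<in>span (feature ` X). f \<bullet> g = g \<bullet> u"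
    by (rule bounded_functional_represented_in_closure[where B = "norm f"])
       (auto simp: inner_add_right Cauchy_Schwarz_ineq2)
  then obtain u where u: "u \<in> closure (span (feature ` X))"
    and "\<And>g. g \<in> span (feature ` X) \<Longrightarrow> f \<bullet> g = g \<bullet> u" by blast
  then have "f \<bullet> feature x = u \<bullet> feature x" if "x \<in> X" for x
    using that by (metis imageI inner_commute span_base)
  then have "f = u" by (rule eq_if_inner_feature_eq)
  with u show ?thesis by simp
qed

text \<open>
  Measurability of the kernel passes to all functions of the space: on the span of the features it is
  inherited from sections of the kernel, and every function is a pointwise limit of functions in the span.
\<close>

lemma inner_feature_measurable:
  assumes M: "space M = X" and kernel: "(\<lambda>(x, y). k x y) \<in> borel_measurable (M \<Otimes>\<^sub>M M)"
  shows "(\<lambda>x. f \<bullet> feature x) \<in> borel_measurable M"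
proof -
  have span: "(\<lambda>x. g \<bullet> feature x) \<in> borel_measurable M" if "g \<in> span (feature ` X)" for g
    using that
  proof (induction rule: span_induct_alt)
    case base
    show ?case by simp
  next
    case (step c h g)
    then obtain y where y: "y \<in> X" and h: "h = feature y" by blast
    have "(\<lambda>x. k y x) \<in> borel_measurable M"
      using measurable_Pair2[OF kernel, of y] y M by simp
    then have [measurable]: "(\<lambda>x. h \<bullet> feature x) \<in> borel_measurable M"
      using y M by (subst measurable_cong[where g = "\<lambda>x. k y x"]) (simp_all add: h inner_feature)
    note [measurable] = step.IH
    show ?case by (simp add: inner_add_left)
  qed
  obtain g where g: "\<And>n. g n \<in> span (feature ` X)" and lim: "g \<longlonglongrightarrow> f"
    using features_dense[of f] unfolding closure_sequential by blast
  show ?thesis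
    by (rule borel_measurable_LIMSEQ_metric[where f = "\<lambda>n x. g n \<bullet> feature x", OF span[OF g]])
      (intro tendsto_intros lim)
qed

lemma norm_feature_le: "x \<in> X \<Longrightarrow> k x x \<le> K \<Longrightarrow> norm (feature x) \<le> sqrt K"
  by (simp add: norm_eq_sqrt_inner inner_feature)

text \<open>
  The mean embedding as a weak integral: \<open>f \<mapsto> \<integral>f\<close> is a bounded functional, and \<open>\<mu>\<close> is its Riesz representer.
\<close>

lemma mean_embedding_exists:
  assumes "prob_space M" and M: "space M = X"
    and kernel: "(\<lambda>(x, y). k x y) \<in> borel_measurable (M \<Otimes>\<^sub>M M)"
    and diag: "\<And>x. x \<in> X \<Longrightarrow> k x x \<le> K"
  shows "\<exists>\<mu>. \<forall>f. (\<integral>x. f \<bullet> feature x \<partial>M) = f \<bullet> \<mu>"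
proof -
  interpret prob_space M by fact
  have bound: "\<bar>f \<bullet> feature x\<bar> \<le> sqrt K * norm f" if "x \<in> space M" for f x
  proof -
    have "\<bar>f \<bullet> feature x\<bar> \<le> norm f * norm (feature x)" by (rule Cauchy_Schwarz_ineq2)
    also have "\<dots> \<le> norm f * sqrt K"
      using that M by (intro mult_left_mono norm_feature_le diag) auto
    finally show ?thesis by (simp add: mult.commute)
  qed
  note meas = inner_feature_measurable[OF M kernel]
  have int: "integrable M (\<lambda>x. f \<bullet> feature x)" for f
    using bound by (intro integrable_const_bound[where B = "sqrt K * norm f"] AE_I2 meas) auto
  have "\<exists>u\<in>closure UNIV. \<forall>f\<in>UNIV. (\<integral>x. f \<bullet> feature x \<partial>M) = f \<bullet> u"
    by (rule bounded_functional_represented_in_closure[where B = "sqrt K"])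
       (auto simp: inner_add_left int intro!: abs_integral_le_bound[OF \<open>prob_space M\<close> meas bound])
  then show ?thesis by auto
qed

end

section \<open>Averaging features over orbits\<close>

locale invariant_rkhs =
  rkhs X fun_of k + group_action G X \<phi>
  for X :: "'a set" and fun_of :: "'h :: {real_inner, complete_space} \<Rightarrow> 'a \<Rightarrow> real"
    and k and G :: "('g, 'm) monoid_scheme" (structure) and \<phi> +
  assumes finite_group: "finite (carrier G)"
    and kernel_invariant: "\<And>\<sigma> x y. \<sigma> \<in> carrier G \<Longrightarrow> x \<in> X \<Longrightarrow> y \<in> X \<Longrightarrow> k (\<phi> \<sigma> x) (\<phi> \<sigma> y) = k x y"
begin

lemma group: "group G"
  using group_hom by (rule group_hom.axioms(1))

lemma order_pos: "0 < order G"
  using finite_group group.is_monoid[OF group] by (auto simp: order_def card_gt_0_iff monoid.one_closed)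

lemma action_closed: "\<sigma> \<in> carrier G \<Longrightarrow> x \<in> X \<Longrightarrow> \<phi> \<sigma> x \<in> X"
  using element_image by blast

text \<open>
  The symmetrised kernel function, which is the orthogonal projection of \<open>feature x\<close> onto the invariant
  functions: it is invariant itself, and it represents evaluation of invariant functions at \<open>x\<close>.
\<close>

definition orbit_feature :: "'a \<Rightarrow> 'h" where
  "orbit_feature x = (1 / real (order G)) *\<^sub>R (\<Sum>\<sigma>\<in>carrier G. feature (\<phi> \<sigma> x))"

lemma orbit_feature_action:
  assumes \<tau>: "\<tau> \<in> carrier G" and x: "x \<in> X"
  shows "orbit_feature (\<phi> \<tau> x) = orbit_feature x"
proof -
  interpret group G by (rule group)
  have "(\<lambda>\<sigma>. \<sigma> \<otimes> \<tau>) ` carrier G = carrier G"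
    using \<tau> by (intro endo_inj_surj finite_group inj_on_multc) auto
  then have "bij_betw (\<lambda>\<sigma>. \<sigma> \<otimes> \<tau>) (carrier G) (carrier G)"
    using inj_on_multc[OF \<tau>] by (simp add: bij_betw_def)
  from sum.reindex_bij_betw[OF this, of "\<lambda>\<sigma>. feature (\<phi> \<sigma> x)"]
  show ?thesis using assms by (simp add: orbit_feature_def composition_rule cong: sum.cong)
qed

lemma inner_orbit_feature:
  assumes "x \<in> X" "y \<in> X"
  shows "orbit_feature x \<bullet> feature y = (\<Sum>\<sigma>\<in>carrier G. k (\<phi> \<sigma> x) y) / real (order G)"
  using assms by (simp add: orbit_feature_def inner_sum_left inner_feature action_closed)

text \<open>
  Invariance of the kernel moves \<open>\<tau>\<close> into the sum over the group, where left translation absorbs it.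
\<close>

lemma orbit_feature_invariant:
  assumes \<tau>: "\<tau> \<in> carrier G" and x: "x \<in> X" and y: "y \<in> X"
  shows "orbit_feature x \<bullet> feature (\<phi> \<tau> y) = orbit_feature x \<bullet> feature y"
proof -
  interpret group G by (rule group)
  have "bij_betw (\<lambda>\<sigma>. \<tau> \<otimes> \<sigma>) (carrier G) (carrier G)"
    unfolding bij_betw_def using \<tau> by (auto simp: inj_on_cmult surj_const_mult)
  from sum.reindex_bij_betw[OF this, of "\<lambda>\<sigma>. k (\<phi> \<sigma> x) (\<phi> \<tau> y)"]
  have "(\<Sum>\<sigma>\<in>carrier G. k (\<phi> \<sigma> x) (\<phi> \<tau> y)) = (\<Sum>\<sigma>\<in>carrier G. k (\<phi> \<sigma> x) y)"
    using assms by (simp add: composition_rule kernel_invariant action_closed cong: sum.cong)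
  then show ?thesis using assms by (simp add: inner_orbit_feature action_closed)
qed

lemma inner_orbit_feature_of_invariant:
  assumes "\<And>\<sigma>. \<sigma> \<in> carrier G \<Longrightarrow> f \<bullet> feature (\<phi> \<sigma> x) = f \<bullet> feature x"
  shows "f \<bullet> orbit_feature x = f \<bullet> feature x"
proof -
  have "(\<Sum>\<sigma>\<in>carrier G. f \<bullet> feature (\<phi> \<sigma> x)) = real (order G) * (f \<bullet> feature x)"
    using assms by (simp add: order_def)
  then show ?thesis using order_pos by (simp add: orbit_feature_def inner_sum_right)
qed

lemma inner_orbit_feature_orbit_feature:
  assumes "x \<in> X" "y \<in> X"
  shows "orbit_feature x \<bullet> orbit_feature y = (\<Sum>\<sigma>\<in>carrier G. k (\<phi> \<sigma> x) y) / real (order G)"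
  using assms by (simp add: inner_orbit_feature_of_invariant orbit_feature_invariant inner_orbit_feature)

text \<open>
  This is the gain from the symmetry. Since \<open>orbit_feature\<close> is constant on orbits,
  the point may be moved into the fundamental domain. There its squared norm is the average of
  \<open>k (\<phi> \<sigma> z) z\<close>, in which only the identity contributes up to \<open>K\<close> and every other element at most \<open>c * K\<close>.
\<close>

lemma norm_orbit_feature_le:
  assumes fd: "fundamental_domain G X \<phi> X0"
    and diag: "\<And>x. x \<in> X \<Longrightarrow> k x x \<le> K"
    and sep: "\<And>\<sigma> x. \<sigma> \<in> carrier G \<Longrightarrow> \<sigma> \<noteq> \<one> \<Longrightarrow> x \<in> X0 \<Longrightarrow> k (\<phi> \<sigma> x) x \<le> c * K"
    and x: "x \<in> X"
  shows "norm (orbit_feature x) \<le> sqrt (K * (1 + c * (real (order G) - 1)) / real (order G))"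
proof -
  interpret group G by (rule group)
  obtain z \<tau> where z: "z \<in> X0" "z \<in> X" and \<tau>: "\<tau> \<in> carrier G" and xz: "x = \<phi> \<tau> z"
    using fd x unfolding fundamental_domain_def by blast
  have "\<phi> \<one> z = z" using id_eq_one z(2) by (metis restrict_apply')
  have "(\<Sum>\<sigma>\<in>carrier G. k (\<phi> \<sigma> z) z) = k (\<phi> \<one> z) z + (\<Sum>\<sigma>\<in>carrier G - {\<one>}. k (\<phi> \<sigma> z) z)"
    using finite_group by (intro sum.remove) auto
  also have "\<dots> \<le> K + (\<Sum>\<sigma>\<in>carrier G - {\<one>}. c * K)"
    using z diag[OF z(2)] \<open>\<phi> \<one> z = z\<close> by (intro add_mono sum_mono sep) auto
  also have "\<dots> = K * (1 + c * (real (order G) - 1))"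
    using finite_group order_pos by (simp add: order_def of_nat_diff algebra_simps)
  finally have "orbit_feature z \<bullet> orbit_feature z \<le> K * (1 + c * (real (order G) - 1)) / real (order G)"
    using z(2) by (simp add: inner_orbit_feature_orbit_feature divide_right_mono)
  then show ?thesis
    using orbit_feature_action[OF \<tau> z(2)] by (simp add: xz norm_eq_sqrt_inner)
qed

lemma inner_orbit_feature_orbit_feature_measurable:
  assumes "sets P = sets M" "sets Q = sets M" and M: "space M = X"
    and kernel: "(\<lambda>(x, y). k x y) \<in> borel_measurable (M \<Otimes>\<^sub>M M)"
    and act: "\<And>\<sigma>. \<sigma> \<in> carrier G \<Longrightarrow> \<phi> \<sigma> \<in> measurable M M"
  shows "(\<lambda>(x, y). orbit_feature x \<bullet> orbit_feature y) \<in> borel_measurable (P \<Otimes>\<^sub>M Q)"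
proof -
  have "(\<lambda>w. k (\<phi> \<sigma> (fst w)) (snd w)) \<in> borel_measurable (M \<Otimes>\<^sub>M M)" if "\<sigma> \<in> carrier G" for \<sigma>
    using measurable_compose[OF measurable_Pair[OF measurable_compose[OF measurable_fst act[OF that]]
        measurable_snd] kernel] by simp
  then have "(\<lambda>w. (\<Sum>\<sigma>\<in>carrier G. k (\<phi> \<sigma> (fst w)) (snd w)) / real (order G)) \<in> borel_measurable (M \<Otimes>\<^sub>M M)"
    by (intro borel_measurable_divide borel_measurable_sum) auto
  then have "(\<lambda>(x, y). orbit_feature x \<bullet> orbit_feature y) \<in> borel_measurable (M \<Otimes>\<^sub>M M)"
    by (subst measurable_cong[where g = "\<lambda>w. (\<Sum>\<sigma>\<in>carrier G. k (\<phi> \<sigma> (fst w)) (snd w)) / real (order G)"])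
      (auto simp: M space_pair_measure inner_orbit_feature_orbit_feature)
  then show ?thesis
    using measurable_cong_sets[OF sets_pair_measure_cong[OF assms(1,2)] refl] by blast
qed

text \<open>
  Averaging over orbits does not move the mean embedding of an invariant measure, because translating the
  argument does not change the integral.
\<close>

lemma orbit_feature_mean:
  assumes "prob_space M" and M: "space M = X"
    and kernel: "(\<lambda>(x, y). k x y) \<in> borel_measurable (M \<Otimes>\<^sub>M M)"
    and diag: "\<And>x. x \<in> X \<Longrightarrow> k x x \<le> K"
    and inv: "invariant_measure G \<phi> M"
  shows "(\<lambda>x. f \<bullet> orbit_feature x) \<in> borel_measurable M"
    and "(\<integral>x. f \<bullet> orbit_feature x \<partial>M) = (\<integral>x. f \<bullet> feature x \<partial>M)"
proof -
  interpret prob_space M by fact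
  have act: "\<phi> \<sigma> \<in> measurable M M" and distr: "distr M M (\<phi> \<sigma>) = M" if "\<sigma> \<in> carrier G" for \<sigma>
    using inv that by (auto simp: invariant_measure_def)
  note meas = inner_feature_measurable[OF M kernel, of f]
  have moved: "(\<lambda>x. f \<bullet> feature (\<phi> \<sigma> x)) \<in> borel_measurable M" if "\<sigma> \<in> carrier G" for \<sigma>
    by (rule measurable_compose[OF act[OF that] meas])
  have expand: "f \<bullet> orbit_feature x = (\<Sum>\<sigma>\<in>carrier G. f \<bullet> feature (\<phi> \<sigma> x)) / real (order G)" for x
    by (simp add: orbit_feature_def inner_sum_right)
  show "(\<lambda>x. f \<bullet> orbit_feature x) \<in> borel_measurable M"
    unfolding expand using moved by (intro borel_measurable_divide borel_measurable_sum) auto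
  have int: "integrable M (\<lambda>x. f \<bullet> feature (\<phi> \<sigma> x))" if "\<sigma> \<in> carrier G" for \<sigma>
  proof (intro integrable_const_bound[where B = "norm f * sqrt K"] AE_I2 moved that)
    fix x assume "x \<in> space M"
    then have "\<phi> \<sigma> x \<in> X" using M action_closed[OF that] by simp
    then have "norm f * norm (feature (\<phi> \<sigma> x)) \<le> norm f * sqrt K"
      by (intro mult_left_mono norm_feature_le diag) auto
    then show "norm (f \<bullet> feature (\<phi> \<sigma> x)) \<le> norm f * sqrt K"
      using Cauchy_Schwarz_ineq2[of f "feature (\<phi> \<sigma> x)"] by simp
  qed
  have same: "(\<integral>x. f \<bullet> feature (\<phi> \<sigma> x) \<partial>M) = (\<integral>x. f \<bullet> feature x \<partial>M)" if "\<sigma> \<in> carrier G" for \<sigma>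
    using integral_distr[OF act[OF that] meas] by (simp add: distr[OF that])
  have "(\<integral>x. f \<bullet> orbit_feature x \<partial>M) = (\<Sum>\<sigma>\<in>carrier G. \<integral>x. f \<bullet> feature (\<phi> \<sigma> x) \<partial>M) / real (order G)"
    unfolding expand using int by (simp add: integral_sum)
  then show "(\<integral>x. f \<bullet> orbit_feature x \<partial>M) = (\<integral>x. f \<bullet> feature x \<partial>M)"
    using order_pos by (simp add: same order_def)
qed

text \<open>
  Centring reduces the second moment, so the bound \<open>V\<close> for the squared norm of \<open>orbit_feature\<close> is also one
  for the variance.
\<close>

lemma centred_orbit_feature:
  assumes "prob_space P" and X: "space P = X"
    and kernel: "(\<lambda>(x, y). k x y) \<in> borel_measurable (P \<Otimes>\<^sub>M P)"
    and diag: "\<And>x. x \<in> X \<Longrightarrow> k x x \<le> K"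
    and inv: "invariant_measure G \<phi> P"
    and \<mu>: "\<And>f. (\<integral>x. f \<bullet> feature x \<partial>P) = f \<bullet> \<mu>"
    and V: "\<And>x. x \<in> X \<Longrightarrow> norm (orbit_feature x) \<le> sqrt V"
  shows "centred_vector P (\<lambda>x. orbit_feature x - \<mu>) V"
proof -
  interpret prob_space P by fact
  note [measurable] = orbit_feature_mean(1)[OF assms(1-5)]
  have mean: "(\<integral>x. f \<bullet> orbit_feature x \<partial>P) = f \<bullet> \<mu>" for f
    using orbit_feature_mean(2)[OF assms(1-5)] \<mu> by simp
  have act: "\<phi> \<sigma> \<in> measurable P P" if "\<sigma> \<in> carrier G" for \<sigma>
    using inv that by (auto simp: invariant_measure_def)
  have [measurable]: "(\<lambda>(x, y). orbit_feature x \<bullet> orbit_feature y) \<in> borel_measurable (P \<Otimes>\<^sub>M P)"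
    by (rule inner_orbit_feature_orbit_feature_measurable[OF refl refl X kernel act])
  have [measurable]: "(\<lambda>x. (norm (orbit_feature x))\<^sup>2) \<in> borel_measurable P"
  proof -
    have "(\<lambda>x. orbit_feature x \<bullet> orbit_feature x) \<in> borel_measurable P" by measurable
    then show ?thesis by (simp add: power2_norm_eq_inner)
  qed
  have int_inner: "integrable P (\<lambda>x. f \<bullet> orbit_feature x)" for f
  proof (intro integrable_const_bound[where B = "norm f * sqrt V"] AE_I2)
    fix x assume "x \<in> space P"
    then have "norm f * norm (orbit_feature x) \<le> norm f * sqrt V"
      using X by (intro mult_left_mono V) auto
    then show "norm (f \<bullet> orbit_feature x) \<le> norm f * sqrt V"
      using Cauchy_Schwarz_ineq2[of f "orbit_feature x"] by simp
  qed measurable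
  have V0: "0 \<le> V"
  proof -
    obtain x where "x \<in> X" using not_empty X by blast
    then show ?thesis using V[of x] norm_ge_zero[of "orbit_feature x"] by (metis order_trans real_sqrt_ge_0_iff)
  qed
  have sq: "(norm (orbit_feature x))\<^sup>2 \<le> V" if "x \<in> X" for x
    using power_mono[OF V[OF that], of 2] V0 by simp
  have int_sq: "integrable P (\<lambda>x. (norm (orbit_feature x))\<^sup>2)"
    using X sq by (intro integrable_const_bound[where B = V] AE_I2) auto
  show ?thesis
  proof unfold_locales
    have "(\<lambda>w. orbit_feature (fst w) \<bullet> orbit_feature (snd w) - \<mu> \<bullet> orbit_feature (fst w)
        - \<mu> \<bullet> orbit_feature (snd w) + \<mu> \<bullet> \<mu>) \<in> borel_measurable (P \<Otimes>\<^sub>M P)" by measurable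
    then show "(\<lambda>(x, y). (orbit_feature x - \<mu>) \<bullet> (orbit_feature y - \<mu>)) \<in> borel_measurable (P \<Otimes>\<^sub>M P)"
      by (simp add: case_prod_beta' inner_diff inner_commute algebra_simps)
  next
    fix v
    show "(\<lambda>x. v \<bullet> (orbit_feature x - \<mu>)) \<in> borel_measurable P"
      unfolding inner_diff_right by measurable
    show "(\<integral>x. v \<bullet> (orbit_feature x - \<mu>) \<partial>P) = 0"
      using int_inner by (simp add: inner_diff_right mean prob_space)
  next
    fix x y assume "x \<in> space P" "y \<in> space P"
    then show "norm (orbit_feature x - \<mu> - (orbit_feature y - \<mu>)) \<le> 2 * sqrt V"
      using V[of x] V[of y] norm_triangle_ineq4[of "orbit_feature x" "orbit_feature y"] X by simp
  next
    have "(\<integral>x. (norm (orbit_feature x - \<mu>))\<^sup>2 \<partial>P)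
        = (\<integral>x. (norm (orbit_feature x))\<^sup>2 - 2 * (\<mu> \<bullet> orbit_feature x) + \<mu> \<bullet> \<mu> \<partial>P)"
      by (simp add: power2_norm_eq_inner inner_diff inner_commute algebra_simps)
    also have "\<dots> = (\<integral>x. (norm (orbit_feature x))\<^sup>2 \<partial>P) - \<mu> \<bullet> \<mu>"
      using int_sq int_inner by (simp add: mean prob_space)
    also have "\<dots> \<le> (\<integral>x. (norm (orbit_feature x))\<^sup>2 \<partial>P)" by simp
    also have "\<dots> \<le> V"
      using int_sq sq X by (intro integral_le_const AE_I2) auto
    finally show "(\<integral>x. (norm (orbit_feature x - \<mu>))\<^sup>2 \<partial>P) \<le> V" .
  qed
qed

end

section \<open>Maximum mean discrepancies as norms\<close>

text \<open>
  The empirical measure is the image of the uniform measure on the indices under \<open>x\<close>.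
\<close>

lemma integral_empirical_measure:
  fixes f :: "'a \<Rightarrow> real"
  assumes n: "n > 0" and x: "\<And>i. i < n \<Longrightarrow> x i \<in> space M" and f: "f \<in> borel_measurable M"
  shows "(\<integral>y. f y \<partial>empirical_measure M n x) = (\<Sum>i<n. f (x i)) / real n"
proof -
  let ?U = "uniform_count_measure {..<n}"
  let ?D = "distr ?U M x"
  have xm: "x \<in> measurable ?U M"
    using x by (auto simp: measurable_def sets_uniform_count_measure space_uniform_count_measure)
  have "(\<Sum>i<n. emeasure (return M (x i)) A) / of_nat n = emeasure ?D A" if A: "A \<in> sets M" for A
  proof -
    have "(\<Sum>i<n. emeasure (return M (x i)) A) = (\<Sum>i<n. of_nat (if x i \<in> A then 1 else 0))"
      using A by (intro sum.cong) (auto simp: indicator_def)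
    also have "\<dots> = of_nat (card (x -` A \<inter> {..<n}))"
      unfolding of_nat_sum[symmetric] by (simp add: sum.If_cases vimage_def Int_def conj_commute)
    also have "\<dots> / of_nat n = emeasure ?D A"
      using A n xm by (simp add: emeasure_distr emeasure_uniform_count_measure space_uniform_count_measure
          divide_ennreal ennreal_of_nat_eq_real_of_nat)
    finally show ?thesis .
  qed
  then have "empirical_measure M n x = measure_of (space ?D) (sets ?D) (emeasure ?D)"
    unfolding empirical_measure_def by (simp, intro measure_of_eq) (auto simp: sets.space_closed sets.sigma_sets_eq)
  then have "empirical_measure M n x = ?D" by (simp only: measure_of_of_measure)
  then show ?thesis
    using integral_distr[OF xm f] by (simp add: integral_uniform_count_measure)
qed

lemma (in rkhs) MMD_eq_norm_mean_difference:
  assumes "space P = X" "space Q = X"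
    and \<mu>: "\<And>f. (\<integral>x. f \<bullet> feature x \<partial>P) = f \<bullet> \<mu>" and \<nu>: "\<And>f. (\<integral>x. f \<bullet> feature x \<partial>Q) = f \<bullet> \<nu>"
  shows "MMD fun_of P Q = norm (\<mu> - \<nu>)"
proof -
  have "(\<integral>x. fun_of f x \<partial>P) = f \<bullet> \<mu>" "(\<integral>x. fun_of f x \<partial>Q) = f \<bullet> \<nu>" for f
    unfolding \<mu>[symmetric] \<nu>[symmetric] using assms(1,2)
    by (auto intro!: Bochner_Integration.integral_cong simp: feature(2))
  then have "MMD fun_of P Q = (SUP f\<in>rkhs_ball. f \<bullet> (\<mu> - \<nu>))"
    by (simp add: MMD_def inner_diff_right)
  also have "\<dots> = norm (\<mu> - \<nu>)"
    by (rule SUP_inner_eq_norm) (auto simp: rkhs_ball_def norm_sgn)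
  finally show ?thesis .
qed

text \<open>
  On invariant functions, evaluation at a sample point is represented by the orbit average of its feature as
  well as by the feature itself. The first representer is invariant too, so the supremum over
  the invariant ball is attained and equals the norm.
\<close>

lemma (in invariant_rkhs) MMD_inv_empirical_eq_norm:
  assumes P: "space P = X" "(\<lambda>(x, y). k x y) \<in> borel_measurable (P \<Otimes>\<^sub>M P)"
    and Q: "space Q = X" "(\<lambda>(x, y). k x y) \<in> borel_measurable (Q \<Otimes>\<^sub>M Q)"
    and "m > 0" "n > 0" and x: "\<And>i. i < m \<Longrightarrow> x i \<in> X" and y: "\<And>j. j < n \<Longrightarrow> y j \<in> X"
  shows "MMD_inv G X \<phi> fun_of (empirical_measure P m x) (empirical_measure Q n y)
    = norm ((1 / real m) *\<^sub>R (\<Sum>i<m. orbit_feature (x i)) - (1 / real n) *\<^sub>R (\<Sum>j<n. orbit_feature (y j)))"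
    (is "_ = norm ?d")
proof -
  have emp: "(\<integral>z. fun_of f z \<partial>empirical_measure M l w) = f \<bullet> ((1 / real l) *\<^sub>R (\<Sum>i<l. orbit_feature (w i)))"
    if M: "space M = X" "(\<lambda>(x, y). k x y) \<in> borel_measurable (M \<Otimes>\<^sub>M M)"
      and l: "l > 0" and w: "\<And>i. i < l \<Longrightarrow> w i \<in> X" and f: "f \<in> invariant_rkhs_ball G X \<phi> fun_of"
    for M l w f
  proof -
    have "fun_of f \<in> borel_measurable M"
      using inner_feature_measurable[OF M, of f] M(1)
      by (subst measurable_cong[where g = "\<lambda>x. f \<bullet> feature x"]) (auto simp: feature(2))
    then have "(\<integral>z. fun_of f z \<partial>empirical_measure M l w) = (\<Sum>i<l. fun_of f (w i)) / real l"
      using l w M(1) by (intro integral_empirical_measure) auto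
    also have "(\<Sum>i<l. fun_of f (w i)) = (\<Sum>i<l. f \<bullet> orbit_feature (w i))"
    proof (rule sum.cong[OF refl])
      fix i assume "i \<in> {..<l}"
      then have wi: "w i \<in> X" using w by simp
      have "f \<bullet> feature (\<phi> \<sigma> (w i)) = f \<bullet> feature (w i)" if "\<sigma> \<in> carrier G" for \<sigma>
        using f that wi action_closed[OF that wi]
        by (simp add: invariant_rkhs_ball_def feature(2)[symmetric])
      from inner_orbit_feature_of_invariant[OF this]
      show "fun_of f (w i) = f \<bullet> orbit_feature (w i)" using wi by (simp add: feature(2))
    qed
    finally show ?thesis by (simp add: inner_sum_right)
  qed
  have "MMD_inv G X \<phi> fun_of (empirical_measure P m x) (empirical_measure Q n y)
      = (SUP f\<in>invariant_rkhs_ball G X \<phi> fun_of. f \<bullet> ?d)"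
    unfolding MMD_inv_def
    by (intro SUP_cong refl) (simp add: emp[OF P] emp[OF Q] assms inner_diff_right)
  also have "\<dots> = norm ?d"
  proof (rule SUP_inner_eq_norm)
    show "norm f \<le> 1" if "f \<in> invariant_rkhs_ball G X \<phi> fun_of" for f
      using that by (simp add: invariant_rkhs_ball_def rkhs_ball_def)
    have "norm (sgn ?d) \<le> 1" unfolding norm_sgn by simp
    moreover have "sgn ?d \<bullet> feature (\<phi> \<sigma> z) = sgn ?d \<bullet> feature z" if "\<sigma> \<in> carrier G" "z \<in> X" for \<sigma> z
      using that x y
      by (simp add: sgn_div_norm inner_diff_left inner_sum_left orbit_feature_invariant)
    ultimately show "sgn ?d \<in> invariant_rkhs_ball G X \<phi> fun_of"
      unfolding invariant_rkhs_ball_def rkhs_ball_def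
      by (simp add: feature(2) action_closed)
  qed
  finally show ?thesis .
qed

theorem theorem8:
  fixes X X0 :: "(real ^ 'd) set"
    and G :: "('g, 'm) monoid_scheme"
    and \<phi> :: "'g \<Rightarrow> real ^ 'd \<Rightarrow> real ^ 'd"
    and fun_of :: "'h :: {real_inner, complete_space} \<Rightarrow> real ^ 'd \<Rightarrow> real"
    and k :: "real ^ 'd \<Rightarrow> real ^ 'd \<Rightarrow> real"
    and K c :: real
    and P Q :: "(real ^ 'd) measure"
  assumes "bounded X"
    and "group_action G X \<phi>" and "finite (carrier G)"
    and "fundamental_domain G X \<phi> X0"
    and "rkhs_on X fun_of k"
    and "(\<lambda>(x, y). k x y) \<in> borel_measurable (restrict_space borel X \<Otimes>\<^sub>M restrict_space borel X)"
    and "\<And>x y. x \<in> X \<Longrightarrow> y \<in> X \<Longrightarrow> k x y \<ge> 0"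
    and "\<And>\<sigma> x y. \<sigma> \<in> carrier G \<Longrightarrow> x \<in> X \<Longrightarrow> y \<in> X \<Longrightarrow> k (\<phi> \<sigma> x) (\<phi> \<sigma> y) = k x y"
    and "\<exists>x\<in>X. \<exists>y\<in>X. k x y = K" and "\<And>x y. x \<in> X \<Longrightarrow> y \<in> X \<Longrightarrow> k x y \<le> K"
    and "K > 0"
    and "\<And>x y. x \<in> X \<Longrightarrow> y \<in> X \<Longrightarrow> k x y = K \<longleftrightarrow> x = y"
    and "0 < c" and "c < 1"
    and "\<And>\<sigma> x. \<sigma> \<in> carrier G \<Longrightarrow> \<sigma> \<noteq> \<one>\<^bsub>G\<^esub> \<Longrightarrow> x \<in> X0 \<Longrightarrow> k (\<phi> \<sigma> x) x \<le> c * K"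
    and "prob_space P" and "sets P = sets (restrict_space borel X)" and "invariant_measure G \<phi> P"
    and "prob_space Q" and "sets Q = sets (restrict_space borel X)" and "invariant_measure G \<phi> Q"
  shows "\<exists>N. \<forall>m\<ge>N. \<forall>n\<ge>N. \<forall>\<epsilon>>0.
    \<P>((x, y) in sample_law P Q m n.
       \<bar>MMD fun_of P Q - MMD_inv G X \<phi> fun_of (empirical_measure P m x) (empirical_measure Q n y)\<bar>
         < 2 * sqrt K * sqrt (1 + c * (real (order G) - 1))
             * (1 / sqrt (real (order G) * real m) + 1 / sqrt (real (order G) * real n))
           + sqrt (2 * K * (1 + c * (real (order G) - 1)) * ln (1 / \<epsilon>) / real (order G))
             * sqrt (1 / real m + 1 / real n))
      \<ge> 1 - \<epsilon>"
proof -
  interpret invariant_rkhs X fun_of k G \<phi>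
    using assms(2,3,5,8) by (intro invariant_rkhs.intro rkhs.intro invariant_rkhs_axioms.intro)
  define V where "V = K * (1 + c * (real (order G) - 1)) / real (order G)"
  have factor: "1 + c * (real (order G) - 1) > 0"
    using order_pos \<open>0 < c\<close> by (intro add_pos_nonneg) auto
  have V: "V > 0" unfolding V_def using factor \<open>K > 0\<close> order_pos by simp
  have X: "space P = X" "space Q = X"
    using sets_eq_imp_space_eq[OF assms(17)] sets_eq_imp_space_eq[OF assms(20)]
    by (simp_all add: space_restrict_space)
  have kernel: "(\<lambda>(x, y). k x y) \<in> borel_measurable (P \<Otimes>\<^sub>M P)" "(\<lambda>(x, y). k x y) \<in> borel_measurable (Q \<Otimes>\<^sub>M Q)"
    using assms(6) measurable_cong_sets[OF sets_pair_measure_cong[OF assms(17) assms(17)] refl]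
      measurable_cong_sets[OF sets_pair_measure_cong[OF assms(20) assms(20)] refl] by blast+
  have diag: "k x x \<le> K" if "x \<in> X" for x using assms(10)[OF that that] .
  obtain \<mu> where \<mu>: "\<And>f. (\<integral>x. f \<bullet> feature x \<partial>P) = f \<bullet> \<mu>"
    using mean_embedding_exists[OF assms(16) X(1) kernel(1) diag] by blast
  obtain \<nu> where \<nu>: "\<And>f. (\<integral>x. f \<bullet> feature x \<partial>Q) = f \<bullet> \<nu>"
    using mean_embedding_exists[OF assms(19) X(2) kernel(2) diag] by blast
  have norm_le: "norm (orbit_feature x) \<le> sqrt V" if "x \<in> X" for x
    unfolding V_def by (rule norm_orbit_feature_le[OF assms(4) diag assms(15) that])
  have cP: "centred_vector P (\<lambda>x. orbit_feature x - \<mu>) V"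
    by (rule centred_orbit_feature[OF assms(16) X(1) kernel(1) diag assms(18) \<mu> norm_le])
  have cQ: "centred_vector Q (\<lambda>x. orbit_feature x - \<nu>) V"
    by (rule centred_orbit_feature[OF assms(19) X(2) kernel(2) diag assms(21) \<nu> norm_le])
  have act: "\<phi> \<sigma> \<in> measurable P P" if "\<sigma> \<in> carrier G" for \<sigma>
    using assms(18) that by (auto simp: invariant_measure_def)
  have PQ: "sets Q = sets P" using assms(17,20) by simp
  note orbit_inner = inner_orbit_feature_orbit_feature_measurable[OF _ _ X(1) kernel(1) act]
  have cross: "(\<lambda>(x, y). (orbit_feature x - \<mu>) \<bullet> (orbit_feature y - \<nu>)) \<in> borel_measurable (P \<Otimes>\<^sub>M Q)"
  proof -
    note [measurable] = orbit_inner[OF refl PQ]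
      orbit_feature_mean(1)[OF assms(16) X(1) kernel(1) diag assms(18)]
      orbit_feature_mean(1)[OF assms(19) X(2) kernel(2) diag assms(21)]
    have "(\<lambda>w. orbit_feature (fst w) \<bullet> orbit_feature (snd w) - \<nu> \<bullet> orbit_feature (fst w)
        - \<mu> \<bullet> orbit_feature (snd w) + \<mu> \<bullet> \<nu>) \<in> borel_measurable (P \<Otimes>\<^sub>M Q)" by measurable
    then show ?thesis by (simp add: case_prod_beta' inner_diff inner_commute algebra_simps)
  qed
  show ?thesis
  \<comment> \<open>One sample point on each side suffices.\<close>
  proof (intro exI[of _ 1] allI impI)
    fix m n :: nat and \<epsilon> :: real
    assume m: "1 \<le> m" and n: "1 \<le> n" and \<epsilon>: "0 < \<epsilon>"
    let ?M = "sample_law P Q m n"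
    let ?E = "\<lambda>(x, y). (1 / real m) *\<^sub>R (\<Sum>i<m. orbit_feature (x i)) - (1 / real n) *\<^sub>R (\<Sum>j<n. orbit_feature (y j))"
    define R where "R = 2 * sqrt K * sqrt (1 + c * (real (order G) - 1))
             * (1 / sqrt (real (order G) * real m) + 1 / sqrt (real (order G) * real n))
           + sqrt (2 * K * (1 + c * (real (order G) - 1)) * ln (1 / \<epsilon>) / real (order G))
             * sqrt (1 / real m + 1 / real n)"
    have MMD_inv: "MMD_inv G X \<phi> fun_of (empirical_measure P m x) (empirical_measure Q n y) = norm (?E (x, y))"
      if "(x, y) \<in> space ?M" for x y
      unfolding prod.case using that m n
      by (intro MMD_inv_empirical_eq_norm[OF X(1) kernel(1) X(2) kernel(2)])
         (auto simp: sample_law_def space_pair_measure space_PiM PiE_iff X)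
    \<comment> \<open>Both discrepancies are norms, so the event is one about a measurable function; this matters because
      the probability of a nonmeasurable set is by convention zero.\<close>
    have event: "{(x, y). (x, y) \<in> space ?M \<and> \<bar>MMD fun_of P Q
          - MMD_inv G X \<phi> fun_of (empirical_measure P m x) (empirical_measure Q n y)\<bar> < R}
        = {w \<in> space ?M. \<bar>norm (\<mu> - \<nu>) - norm (?E w)\<bar> < R}"
      by (auto simp: MMD_inv MMD_eq_norm_mean_difference[OF X \<mu> \<nu>])
    interpret PP: prob_space "PiM {..<m} (\<lambda>_. P)" by (intro prob_space_PiM assms)
    interpret QQ: prob_space "PiM {..<n} (\<lambda>_. Q)" by (intro prob_space_PiM assms)
    interpret pair: pair_prob_space "PiM {..<m} (\<lambda>_. P)" "PiM {..<n} (\<lambda>_. Q)" ..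
    interpret M: prob_space ?M unfolding sample_law_def by (rule pair.P.prob_space_axioms)
    have "1 - \<epsilon> \<le> measure ?M {w \<in> space ?M. \<bar>norm (\<mu> - \<nu>) - norm (?E w)\<bar> < R}"
    proof (cases "\<epsilon> < 1")
      case False
      \<comment> \<open>For \<open>\<epsilon> \<ge> 1\<close> the claim only says that probabilities are nonnegative.\<close>
      then show ?thesis using measure_nonneg[of ?M] by (smt (verit))
    next
      case True
      define D where "D = (\<lambda>x y. norm ((1 / real m) *\<^sub>R (\<Sum>i<m. orbit_feature (x i) - \<mu>)
        - (1 / real n) *\<^sub>R (\<Sum>j<n. orbit_feature (y j) - \<nu>)))"
      define r where "r = sqrt V * (1 / sqrt (real m) + 1 / sqrt (real n))
        + sqrt (2 * V * ln (1 / \<epsilon>)) * sqrt (1 / real m + 1 / real n)"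
      have "case_prod D \<in> borel_measurable ?M"
        unfolding D_def
        by (rule norm_mean_difference_measurable[OF centred_vector.inner_measurable[OF cP]
              centred_vector.inner_measurable[OF cQ] cross])
      note [measurable] = this
      have "(\<lambda>w. norm (?E w)) \<in> borel_measurable ?M"
        using norm_mean_difference_measurable[OF orbit_inner[OF refl refl] orbit_inner[OF PQ PQ]
            orbit_inner[OF refl PQ], of m n]
        by (simp add: case_prod_beta')
      note [measurable] = this
      have bad: "measure ?M {w \<in> space ?M. r \<le> case_prod D w} \<le> \<epsilon>"
        unfolding r_def D_def
        using two_sample_mean_concentration[OF cP cQ cross V, of m n \<epsilon>] m n \<epsilon> True by simp
      \<comment> \<open>The bound of the concentration inequality \<open>r\<close> agrees with \<open>R\<close> except that its first summand is half as large.\<close>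
      have "r \<le> R"
      proof -
        have "sqrt K * sqrt q * (1 / sqrt (real (order G) * real m) + 1 / sqrt (real (order G) * real n))
            = sqrt (K * q / real (order G)) * (1 / sqrt (real m) + 1 / sqrt (real n))" for q
          by (simp add: real_sqrt_mult real_sqrt_divide distrib_left add_divide_distrib mult_ac)
        then have "sqrt K * sqrt (1 + c * (real (order G) - 1))
            * (1 / sqrt (real (order G) * real m) + 1 / sqrt (real (order G) * real n))
            = sqrt V * (1 / sqrt (real m) + 1 / sqrt (real n))" unfolding V_def .
        moreover have "0 \<le> sqrt V * (1 / sqrt (real m) + 1 / sqrt (real n))" using V by simp
        moreover have "2 * K * (1 + c * (real (order G) - 1)) * ln (1 / \<epsilon>) / real (order G) = 2 * V * ln (1 / \<epsilon>)"
          by (simp add: V_def)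
        ultimately show ?thesis unfolding r_def R_def by (simp only: mult.assoc)
      qed
      \<comment> \<open>The reverse triangle inequality, with the population means absorbed into the sample means.\<close>
      have dist: "\<bar>norm (\<mu> - \<nu>) - norm (?E w)\<bar> \<le> case_prod D w" for w
      proof -
        have "D (fst w) (snd w) = norm (?E w - (\<mu> - \<nu>))"
          unfolding D_def using m n
          by (simp add: case_prod_beta' sum_subtractf scaleR_diff_right sum_constant_scaleR algebra_simps)
        then show ?thesis
          using norm_triangle_ineq3[of "?E w" "\<mu> - \<nu>"] by (simp add: case_prod_beta' abs_minus_commute)
      qed
      have "1 - \<epsilon> \<le> 1 - measure ?M {w \<in> space ?M. r \<le> case_prod D w}" using bad by simp
      also have "\<dots> = measure ?M {w \<in> space ?M. \<not> r \<le> case_prod D w}"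
        by (rule M.prob_neg[symmetric]) measurable
      also have "\<dots> \<le> measure ?M {w \<in> space ?M. \<bar>norm (\<mu> - \<nu>) - norm (?E w)\<bar> < R}"
      proof (rule M.finite_measure_mono)
        show "{w \<in> space ?M. \<not> r \<le> case_prod D w} \<subseteq> {w \<in> space ?M. \<bar>norm (\<mu> - \<nu>) - norm (?E w)\<bar> < R}"
        proof (intro Collect_mono impI conjI)
          fix w assume w: "w \<in> space ?M \<and> \<not> r \<le> case_prod D w"
          then show "w \<in> space ?M" by simp
          show "\<bar>norm (\<mu> - \<nu>) - norm (?E w)\<bar> < R" using dist[of w] \<open>r \<le> R\<close> w by linarith
        qed
      qed measurable
      finally show ?thesis .
    qed
    then show "1 - \<epsilon> \<le> \<P>((x, y) in ?M.
       \<bar>MMD fun_of P Q - MMD_inv G X \<phi> fun_of (empirical_measure P m x) (empirical_measure Q n y)\<bar>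
         < 2 * sqrt K * sqrt (1 + c * (real (order G) - 1))
             * (1 / sqrt (real (order G) * real m) + 1 / sqrt (real (order G) * real n))
           + sqrt (2 * K * (1 + c * (real (order G) - 1)) * ln (1 / \<epsilon>) / real (order G))
             * sqrt (1 / real m + 1 / real n))"
      unfolding R_def event[unfolded R_def, symmetric] .
  qed
qed

end
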